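(* Let $d\ge1$, let $S$ be a homogeneous Poisson process in $\mathbb{R}^d$, and let $S^{\circ}$ be its Palm version. Then there exist a measurable set $\mathcal{S}^{\circ}$ of locally finite subsets of $\mathbb{R}^d$ containing $0$, with $\mathbb{P}(S^{\circ}\in\mathcal{S}^{\circ})=1$, and a measurable map $\pi:\mathcal{S}^{\circ}\to\mathbb{R}^d\setminus\{0\}$ such that, with $X=\pi(S^{\circ})$, one has $X\in S^{\circ}\setminus\{0\}$ and $$S^{\circ}-X = S^{\circ}\quad\text{in distribution.}$$
   Context: The Palm version $S^{\circ}$ of the Poisson process $S$ is a random set with the same distribution as $S\cup\{0\}$. For a set $\omega\subset\mathbb{R}^d$ and $x\in\mathbb{R}^d$, $\omega-x=\{s-x:s\in\omega\}$. Locally finite configurations carry the usual $\sigma$-algebra generated by the counting maps $\omega\mapsto|\omega\cap A|$, $A$ bounded Borel. The map $\pi$ is non-randomized: it is a function of the configuration only. *)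

theory Defs
  imports "HOL-Probability.Probability"
begin

definition locally_finite_sets :: "'a::metric_space set set" where
  "locally_finite_sets = {\<omega>. \<forall>B. bounded B \<longrightarrow> finite (\<omega> \<inter> B)}"

(* The generator consists of the preimages of the singletons {k} under the counting maps;
   these maps take values in the countable set of natural numbers on locally_finite_sets. *)
definition config_space :: "'a::metric_space set measure" where
  "config_space =
     sigma locally_finite_sets
       {{\<omega> \<in> locally_finite_sets. card (\<omega> \<inter> A) = k} | A k. A \<in> sets borel \<and> bounded A}"

definition translate :: "'a::ab_group_add set \<Rightarrow> 'a \<Rightarrow> 'a set" where
  "translate \<omega> x = (\<lambda>s. s - x) ` \<omega>"

(* Measurability is part of the notion: distr does not check it. *)
definition equal_in_distribution ::
    "'a measure \<Rightarrow> ('a \<Rightarrow> 'c) \<Rightarrow> 'b measure \<Rightarrow> ('b \<Rightarrow> 'c) \<Rightarrow> 'c measure \<Rightarrow> bool" where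
  "equal_in_distribution M X N Y K \<longleftrightarrow>
     X \<in> measurable M K \<and> Y \<in> measurable N K \<and> distr M K X = distr N K Y"

(* The mass function is written out because poisson_pmf requires a positive rate,
   whereas A may be a null set here. *)
definition homogeneous_poisson_process ::
    "'w measure \<Rightarrow> real \<Rightarrow> ('w \<Rightarrow> 'a::euclidean_space set) \<Rightarrow> bool" where
  "homogeneous_poisson_process M lam S \<longleftrightarrow>
     prob_space M \<and> lam > 0 \<and> S \<in> measurable M config_space \<and>
     (\<forall>A k. A \<in> sets borel \<and> bounded A \<longrightarrow>
        measure M {w \<in> space M. card (S w \<inter> A) = k} =
          (lam * measure lborel A) ^ k / fact k * exp (- (lam * measure lborel A))) \<and>
     (\<forall>\<A>. finite \<A> \<and> disjoint \<A> \<and> (\<forall>A\<in>\<A>. A \<in> sets borel \<and> bounded A) \<longrightarrow>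
        prob_space.indep_vars M (\<lambda>_. count_space UNIV) (\<lambda>A w. card (S w \<inter> A)) \<A>)"

definition palm_version ::
    "'w measure \<Rightarrow> ('w \<Rightarrow> 'a::euclidean_space set) \<Rightarrow> 'v measure \<Rightarrow> ('v \<Rightarrow> 'a set) \<Rightarrow> bool" where
  "palm_version M S N S0 \<longleftrightarrow>
     prob_space N \<and> equal_in_distribution N S0 M (\<lambda>w. S w \<union> {0}) config_space"

end

theory Submission
  imports Defs
begin

text \<open>
The point \<open>X\<close> is the partner of the origin in a matching of the points that is determined by the configuration
and commutes with translations. If every point has a partner, moving the origin to its partner is an involution
on the points, and a symmetry argument shows that it preserves the Palm distribution.

The symmetry is the mass transport principle (lemma \<open>exchange\<close>): for the process with an added point at
the origin, the mean mass that the origin sends to other points equals the mean mass that it receives, whenever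
the mass sent from one point to another depends on the configuration in a translation-covariant way. It follows
from the Mecke equation (lemma \<open>Mecke\<close>) and stationarity; both are proved by
comparing measures on void events \<open>\<omega> \<inter> A = {}\<close>, which generate the sigma-algebra of configurations
and are closed under intersection (lemma \<open>sets_config_space_eq_void\<close>).

The matching is built greedily. Fix a countable family of symmetric windows. In round \<open>n\<close>, two
points that are still single are matched if each is the only point of the configuration that the other one
sees through the \<open>n\<close>-th window. Almost surely no three points are in arithmetic progression, and then every pair of
points is isolated in this way by a sufficiently small window, so at most one point remains single forever
(lemma \<open>no_two_unmatched\<close>). If there could be a single point, let all other points send unit mass to it: nobody
sends more than mass \<open>1\<close>, but the single point receives infinite mass, since the configuration is infinite. By mass
transport this has probability zero (lemma \<open>AE_palm_matched\<close>), and a second mass transport, in which each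
point sends mass to its partner, gives the equality in distribution (lemma \<open>palm_shift_to_partner\<close>).
\<close>

section \<open>The counting sigma-algebra is generated by void events\<close>
lemma space_config [simp]: "space config_space = locally_finite_sets"
  unfolding config_space_def by (rule space_measure_of) auto

lemma finite_config_Int:
  "\<omega> \<in> locally_finite_sets \<Longrightarrow> bounded A \<Longrightarrow> finite (\<omega> \<inter> A)"
  by (simp add: locally_finite_sets_def)

definition void_event :: "'a::metric_space set \<Rightarrow> 'a set set" where
  "void_event A = {\<omega> \<in> locally_finite_sets. \<omega> \<inter> A = {}}"

lemma card_event_in_config:
  assumes "A \<in> sets borel" "bounded A"
  shows "{\<omega> \<in> locally_finite_sets. card (\<omega> \<inter> A) = k} \<in> sets config_space"
  unfolding config_space_def using assms
  by (subst sets_measure_of) (auto intro!: sigma_sets.Basic)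

lemma void_event_in_config:
  assumes "A \<in> sets borel" "bounded A"
  shows "void_event A \<in> sets config_space"
proof -
  have "void_event A = {\<omega> \<in> locally_finite_sets. card (\<omega> \<inter> A) = 0}"
    using assms(2) by (auto simp: void_event_def card_eq_0_iff dest: finite_config_Int)
  then show ?thesis using card_event_in_config[OF assms] by simp
qed

text \<open>A finite set has at least \<open>k\<close> points iff \<open>k\<close> disjoint basic open sets hit it. Applied with a countable
basis, this turns counts into countable combinations of hitting events, each of which is the
complement of a void event.\<close>
lemma card_ge_iff_disjoint_neighbourhoods:
  fixes P :: "'a::metric_space set" and \<B> :: "'a set set"
  assumes B: "topological_basis \<B>" and fin: "finite P"
  shows "k \<le> card P \<longleftrightarrow>
    (\<exists>F. F \<subseteq> \<B> \<and> finite F \<and> disjoint F \<and> card F = k \<and> (\<forall>b\<in>F. P \<inter> b \<noteq> {}))"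
proof
  assume "k \<le> card P"
  then obtain T where T: "T \<subseteq> P" "card T = k" "finite T"
    using fin by (meson finite_subset obtain_subset_with_card_n)
  obtain e where e: "e > 0" "\<And>x y. x \<in> T \<Longrightarrow> y \<in> T \<Longrightarrow> x \<noteq> y \<Longrightarrow> e \<le> dist x y"
  proof -
    define D where "D = (\<lambda>(x, y). dist x y) ` {(x, y). x \<in> T \<and> y \<in> T \<and> x \<noteq> y}"
    have "finite {(x, y). x \<in> T \<and> y \<in> T \<and> x \<noteq> y}"
      by (rule finite_subset[of _ "T \<times> T"]) (use T in auto)
    then have D: "finite (insert 1 D)" by (simp add: D_def)
    show ?thesis
    proof (rule that[of "Min (insert 1 D)"])
      show "0 < Min (insert 1 D)" using D by (auto simp: D_def)
      show "Min (insert 1 D) \<le> dist x y" if "x \<in> T" "y \<in> T" "x \<noteq> y" for x y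
        by (rule Min_le[OF D]) (use that in \<open>auto simp: D_def\<close>)
    qed
  qed
  have "\<exists>b\<in>\<B>. x \<in> b \<and> b \<subseteq> ball x (e / 2)" for x
    using topological_basisE[OF B, of "ball x (e/2)" x] e(1) by (metis centre_in_ball half_gt_zero open_ball)
  then obtain b where b: "\<And>x. b x \<in> \<B>" "\<And>x. x \<in> b x" "\<And>x. b x \<subseteq> ball x (e / 2)"
    by metis
  have dis: "b x \<inter> b y = {}" if "x \<in> T" "y \<in> T" "x \<noteq> y" for x y
  proof (rule ccontr)
    assume "b x \<inter> b y \<noteq> {}"
    then obtain z where "dist x z < e / 2" "dist y z < e / 2" using b(3) by fastforce
    then show False using e(2)[OF that] dist_triangle2[of x y z] by linarith
  qed
  have inj: "inj_on b T"
  proof (rule inj_onI, rule ccontr)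
    fix x y assume "x \<in> T" "y \<in> T" "b x = b y" "x \<noteq> y"
    then show False using dis[of x y] b(2)[of x] by auto
  qed
  show "\<exists>F. F \<subseteq> \<B> \<and> finite F \<and> disjoint F \<and> card F = k \<and> (\<forall>b\<in>F. P \<inter> b \<noteq> {})"
  proof (intro exI[of _ "b ` T"] conjI)
    show "disjoint (b ` T)"
    proof (rule disjointI)
      fix u v assume "u \<in> b ` T" "v \<in> b ` T" "u \<noteq> v"
      then obtain x y where "x \<in> T" "y \<in> T" "u = b x" "v = b y" "x \<noteq> y" by auto
      then show "u \<inter> v = {}" using dis by simp
    qed
    show "card (b ` T) = k" using inj T by (simp add: card_image)
    show "\<forall>c\<in>b ` T. P \<inter> c \<noteq> {}" using b(2) T(1) by blast
  qed (use b T in auto)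
next
  assume "\<exists>F. F \<subseteq> \<B> \<and> finite F \<and> disjoint F \<and> card F = k \<and> (\<forall>b\<in>F. P \<inter> b \<noteq> {})"
  then obtain F where F: "finite F" "disjoint F" "card F = k" "\<forall>b\<in>F. P \<inter> b \<noteq> {}" by blast
  from F(4) have "\<forall>b\<in>F. \<exists>p. p \<in> P \<inter> b" by blast
  then obtain p where p: "\<And>b. b \<in> F \<Longrightarrow> p b \<in> P \<inter> b" by metis
  have "inj_on p F"
  proof (rule inj_onI, rule ccontr)
    fix u v assume "u \<in> F" "v \<in> F" "p u = p v" "u \<noteq> v"
    then show False using p[of u] p[of v] disjointD[OF F(2), of u v] by auto
  qed
  then show "k \<le> card P" using card_inj_on_le[of p F P] p F(3) fin by blast
qed

text \<open>This reduces the whole measure theory to void events: maps into configurations are measurable, and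
laws of configurations agree, as soon as this can be verified on events \<open>\<omega> \<inter> A = {}\<close>. In contrast to the
counting events, void events are closed under intersection.\<close>
lemma sets_config_space_eq_void:
  "sets (config_space :: 'a::euclidean_space set measure) =
    sigma_sets locally_finite_sets {void_event A | A. A \<in> sets borel \<and> bounded A}"
    (is "_ = sigma_sets ?L ?G")
proof
  show "sigma_sets ?L ?G \<subseteq> sets config_space"
    using sets.sigma_sets_subset[of ?G config_space] void_event_in_config by auto
  obtain \<B> :: "'a set set" where \<B>: "countable \<B>" "topological_basis \<B>"
    using ex_countable_basis by blast
  define \<Sigma> where "\<Sigma> = sigma ?L ?G"
  have "?G \<subseteq> Pow ?L" by (auto simp: void_event_def)
  then have sp: "space \<Sigma> = ?L" and st: "sets \<Sigma> = sigma_sets ?L ?G"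
    by (auto simp: \<Sigma>_def)
  have ge: "{\<omega> \<in> space \<Sigma>. k \<le> card (\<omega> \<inter> A)} \<in> sets \<Sigma>"
    if A: "A \<in> sets borel" "bounded A" for A k
  proof -
    define \<F> where "\<F> = {F. F \<subseteq> \<B> \<and> finite F \<and> disjoint F \<and> card F = k}"
    have "countable \<F>"
      by (rule countable_subset[OF _ countable_Collect_finite_subset[OF \<B>(1)]])
        (auto simp: \<F>_def)
    have void: "{\<omega> \<in> space \<Sigma>. \<omega> \<inter> A \<inter> b \<noteq> {}} \<in> sets \<Sigma>" if "b \<in> \<B>" for b
    proof -
      have "open b" using that \<B>(2) topological_basis_open by blast
      then have "void_event (A \<inter> b) \<in> sets \<Sigma>"
        unfolding st using A by (intro sigma_sets.Basic) (auto intro!: exI[of _ "A \<inter> b"] bounded_Int)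
      then have "space \<Sigma> - void_event (A \<inter> b) \<in> sets \<Sigma>" by blast
      also have "space \<Sigma> - void_event (A \<inter> b) = {\<omega> \<in> space \<Sigma>. \<omega> \<inter> A \<inter> b \<noteq> {}}"
        by (auto simp: void_event_def sp)
      finally show ?thesis .
    qed
    have "{\<omega> \<in> space \<Sigma>. \<forall>b\<in>F. \<omega> \<inter> A \<inter> b \<noteq> {}} \<in> sets \<Sigma>" if "F \<in> \<F>" for F
      using that by (cases "F = {}", simp, intro sets.sets_Collect_finite_All' void) (auto simp: \<F>_def)
    then have "(\<Union>F\<in>\<F>. {\<omega> \<in> space \<Sigma>. \<forall>b\<in>F. \<omega> \<inter> A \<inter> b \<noteq> {}}) \<in> sets \<Sigma>"
      using \<open>countable \<F>\<close> by (intro sets.countable_UN'') auto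
    also have "(\<Union>F\<in>\<F>. {\<omega> \<in> space \<Sigma>. \<forall>b\<in>F. \<omega> \<inter> A \<inter> b \<noteq> {}}) =
        {\<omega> \<in> space \<Sigma>. k \<le> card (\<omega> \<inter> A)}"
      using A(2) by (auto simp: card_ge_iff_disjoint_neighbourhoods[OF \<B>(2)] finite_config_Int sp \<F>_def) blast
    finally show ?thesis .
  qed
  have eq: "{\<omega> \<in> ?L. card (\<omega> \<inter> A) = k} \<in> sets \<Sigma>" if "A \<in> sets borel" "bounded A" for A k
  proof -
    have "{\<omega> \<in> ?L. card (\<omega> \<inter> A) = k} =
        {\<omega> \<in> space \<Sigma>. k \<le> card (\<omega> \<inter> A)} - {\<omega> \<in> space \<Sigma>. Suc k \<le> card (\<omega> \<inter> A)}"
      by (auto simp: sp)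
    then show ?thesis using ge[OF that] by auto
  qed
  show "sets config_space \<subseteq> sigma_sets ?L ?G"
  proof -
    let ?C = "{{\<omega> \<in> ?L. card (\<omega> \<inter> A) = k} | A k. A \<in> sets borel \<and> bounded A}"
    have "?C \<subseteq> sets \<Sigma>" using eq by blast
    then have "sigma_sets ?L ?C \<subseteq> sets \<Sigma>" using sets.sigma_sets_subset[of ?C \<Sigma>] sp by simp
    moreover have "sets config_space = sigma_sets ?L ?C"
      unfolding config_space_def by (subst sets_measure_of) auto
    ultimately show ?thesis by (simp add: st)
  qed
qed

lemma measurable_configI:
  fixes F :: "'x \<Rightarrow> 'a::euclidean_space set"
  assumes "\<And>x. x \<in> space X \<Longrightarrow> F x \<in> locally_finite_sets"
    and "\<And>A. A \<in> sets borel \<Longrightarrow> bounded A \<Longrightarrow> {x \<in> space X. F x \<inter> A = {}} \<in> sets X"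
  shows "F \<in> measurable X config_space"
proof (rule measurable_sigma_sets[OF sets_config_space_eq_void])
  show "F -` y \<inter> space X \<in> sets X"
    if "y \<in> {void_event A |A. A \<in> sets borel \<and> bounded A}" for y
  proof -
    from that obtain A where A: "y = void_event A" "A \<in> sets borel" "bounded A" by blast
    have "F -` y \<inter> space X = {x \<in> space X. F x \<inter> A = {}}"
      using assms(1) by (auto simp: A void_event_def)
    then show ?thesis using assms(2) A by simp
  qed
qed (use assms(1) in \<open>auto simp: void_event_def\<close>)

lemma measurable_card_Int [measurable]:
  assumes "A \<in> sets borel" "bounded A"
  shows "(\<lambda>\<omega>. card (\<omega> \<inter> A)) \<in> measurable config_space (count_space UNIV)"
proof (rule measurable_count_space_eq_countable[THEN iffD2])
  show "(\<lambda>\<omega>. card (\<omega> \<inter> A)) \<in> space config_space \<rightarrow> UNIV \<and>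
    (\<forall>a\<in>UNIV. (\<lambda>\<omega>. card (\<omega> \<inter> A)) -` {a} \<inter> space config_space \<in> sets config_space)"
    using card_event_in_config[OF assms] by (auto simp: vimage_def Int_def conj_commute)
qed auto

lemma nn_integral_count_space_indicator_card:
  "finite (A \<inter> B) \<Longrightarrow> (\<integral>\<^sup>+ s. indicator B s \<partial>count_space A) = of_nat (card (A \<inter> B))"
  using nn_integral_count_space'[of "A \<inter> B" A "indicator B :: _ \<Rightarrow> ennreal" ]
  by (auto simp: indicator_def)

section \<open>Sums over the points of a random configuration\<close>
text \<open>The restriction to a bounded window makes all sums finite, so that complements can be
handled by subtraction in a Dynkin argument.\<close>
lemma measurable_point_sum_bounded:
  fixes g :: "'x \<Rightarrow> 'a::euclidean_space set"
  assumes g [measurable]: "g \<in> measurable X config_space"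
    and Q: "Q \<in> sets (X \<Otimes>\<^sub>M borel)" and B: "B \<in> sets borel" "bounded B"
  shows "(\<lambda>x. \<integral>\<^sup>+ s. indicator Q (x, s) * indicator B s \<partial>count_space (g x)) \<in> borel_measurable X"
    (is "?I Q \<in> _")
  using Int_stable_pair_measure_generator pair_measure_closed Q[unfolded sets_pair_measure]
proof (induction rule: sigma_sets_induct_disjoint)
  have fin: "finite (g x \<inter> B)" if "x \<in> space X" for x
    using measurable_space[OF g that] B(2) by (auto intro: finite_config_Int)
  {
    case (basic Q)
    then obtain a b where ab: "Q = a \<times> b" "a \<in> sets X" "b \<in> sets borel" by auto
    note [measurable] = ab(2)
    have "?I Q x = indicator a x * of_nat (card (g x \<inter> (b \<inter> B)))" if "x \<in> space X" for x
    proof -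
      have fin': "finite (g x \<inter> (b \<inter> B))"
        using fin[OF that] by (rule rev_finite_subset) auto
      have "?I Q x = (\<integral>\<^sup>+ s. indicator a x * indicator (b \<inter> B) s \<partial>count_space (g x))"
        by (intro nn_integral_cong) (auto simp: ab(1) indicator_def)
      also have "\<dots> = indicator a x * of_nat (card (g x \<inter> (b \<inter> B)))"
        by (simp add: nn_integral_cmult nn_integral_count_space_indicator_card[OF fin'])
      finally show ?thesis .
    qed
    moreover have "(\<lambda>\<omega>. card (\<omega> \<inter> (b \<inter> B))) \<in> measurable config_space (count_space UNIV)"
      using ab(3) B by (intro measurable_card_Int) (auto intro: bounded_subset)
    then have [measurable]: "(\<lambda>x. card (g x \<inter> (b \<inter> B))) \<in> measurable X (count_space UNIV)"
      using measurable_compose[OF g] by simp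
    have "(\<lambda>x. indicator a x * of_nat (card (g x \<inter> (b \<inter> B))) :: ennreal) \<in> borel_measurable X"
      by measurable
    ultimately show ?case by (simp cong: measurable_cong)
  next
    case empty
    show ?case by simp
  next
    case (compl Q)
    have "?I (space X \<times> space borel - Q) x =
        of_nat (card (g x \<inter> B)) - ?I Q x" if x: "x \<in> space X" for x
    proof -
      have "?I Q x \<le> (\<integral>\<^sup>+ s. indicator B s \<partial>count_space (g x))"
        by (intro nn_integral_mono) (auto simp: indicator_def)
      also have "\<dots> = of_nat (card (g x \<inter> B))"
        by (rule nn_integral_count_space_indicator_card[OF fin[OF x]])
      finally have "?I Q x \<noteq> \<infinity>" by (auto simp: top_unique)
      then have "(\<integral>\<^sup>+ s. indicator B s - indicator Q (x, s) * indicator B s \<partial>count_space (g x)) =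
          (\<integral>\<^sup>+ s. indicator B s \<partial>count_space (g x)) - ?I Q x"
        by (intro nn_integral_diff) (auto simp: indicator_def)
      moreover have "?I (space X \<times> space borel - Q) x =
          (\<integral>\<^sup>+ s. indicator B s - indicator Q (x, s) * indicator B s \<partial>count_space (g x))"
        using x by (intro nn_integral_cong) (auto simp: indicator_def)
      ultimately show ?thesis
        by (simp add: nn_integral_count_space_indicator_card[OF fin[OF x]])
    qed
    moreover have [measurable]: "(\<lambda>x. card (g x \<inter> B)) \<in> measurable X (count_space UNIV)"
      using measurable_compose[OF g measurable_card_Int[OF B]] by simp
    have "(\<lambda>x. of_nat (card (g x \<inter> B)) - ?I Q x) \<in> borel_measurable X"
      using compl(2) by measurable
    ultimately show ?case by (simp cong: measurable_cong)
  next
    case (union Q)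
    have "?I (\<Union>i. Q i) = (\<lambda>x. \<Sum>i. ?I (Q i) x)"
    proof
      fix x
      have "?I (\<Union>i. Q i) x =
          (\<integral>\<^sup>+ s. (\<Sum>i. indicator (Q i) (x, s) * indicator B s) \<partial>count_space (g x))"
        by (intro nn_integral_cong)
          (simp only: ennreal_suminf_multc suminf_indicator[OF union(1)])
      also have "\<dots> = (\<Sum>i. ?I (Q i) x)" by (intro nn_integral_suminf) auto
      finally show "?I (\<Union>i. Q i) x = (\<Sum>i. ?I (Q i) x)" .
    qed
    then show ?case using union(3) by simp
  }
qed

lemma measurable_point_sum_indicator:
  fixes g :: "'x \<Rightarrow> 'a::euclidean_space set"
  assumes g: "g \<in> measurable X config_space" and Q: "Q \<in> sets (X \<Otimes>\<^sub>M borel)"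
  shows "(\<lambda>x. \<integral>\<^sup>+ s. indicator Q (x, s) \<partial>count_space (g x)) \<in> borel_measurable X"
proof -
  have "(\<integral>\<^sup>+ s. indicator Q (x, s) \<partial>count_space (g x)) =
      (SUP n::nat. \<integral>\<^sup>+ s. indicator Q (x, s) * indicator (ball 0 (real n)) s \<partial>count_space (g x))" for x
  proof -
    have "(SUP n::nat. indicator Q (x, s) * indicator (ball 0 (real n)) s) = (indicator Q (x, s) :: ennreal)" for s
    proof (rule antisym)
      obtain n where "norm s < real n" using reals_Archimedean2 by blast
      then show "indicator Q (x, s) \<le> (SUP n::nat. indicator Q (x, s) * indicator (ball 0 (real n)) s :: ennreal)"
        by (intro SUP_upper2[of n]) auto
    qed (auto intro!: SUP_least simp: indicator_def)
    then have "(\<integral>\<^sup>+ s. indicator Q (x, s) \<partial>count_space (g x)) =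
       (\<integral>\<^sup>+ s. (SUP n::nat. indicator Q (x, s) * indicator (ball 0 (real n)) s) \<partial>count_space (g x))"
      by simp
    also have "\<dots> = (SUP n::nat. \<integral>\<^sup>+ s. indicator Q (x, s) * indicator (ball 0 (real n)) s \<partial>count_space (g x))"
      by (intro nn_integral_monotone_convergence_SUP)
        (auto simp: incseq_def le_fun_def indicator_def)
    finally show ?thesis .
  qed
  then show ?thesis
    by (simp add: measurable_point_sum_bounded[OF g Q] borel_measurable_SUP)
qed

text \<open>The points of a configuration come without a measurable enumeration; this lemma and
\<open>measurable_Bex_point\<close> replace one, and make measurability automatic for everything below that is
expressed through sums or quantifiers over points.\<close>
lemma measurable_point_sum [measurable (raw)]:
  fixes g :: "'x \<Rightarrow> 'a::euclidean_space set"
  assumes g: "g \<in> measurable X config_space" and f: "case_prod f \<in> borel_measurable (X \<Otimes>\<^sub>M borel)"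
  shows "(\<lambda>x. \<integral>\<^sup>+ s. f x s \<partial>count_space (g x)) \<in> borel_measurable X"
proof -
  have "(\<lambda>x. \<integral>\<^sup>+ s. h (x, s) \<partial>count_space (g x)) \<in> borel_measurable X"
    if "h \<in> borel_measurable (X \<Otimes>\<^sub>M borel)" for h :: "'x \<times> 'a \<Rightarrow> ennreal"
    using that
  proof (induction rule: borel_measurable_induct)
    case (cong u v)
    have "(\<integral>\<^sup>+ s. u (x, s) \<partial>count_space (g x)) = (\<integral>\<^sup>+ s. v (x, s) \<partial>count_space (g x))" if "x \<in> space X" for x
      using that cong(3) by (intro nn_integral_cong) (auto simp: space_pair_measure)
    then show ?case using cong(4) by (simp cong: measurable_cong)
  next
    case (set A)
    then show ?case using measurable_point_sum_indicator[OF g] by simp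
  next
    case (mult u c)
    then show ?case by (simp add: nn_integral_cmult)
  next
    case (add u v)
    then show ?case by (simp add: nn_integral_add)
  next
    case (seq U)
    have "(\<integral>\<^sup>+ s. (SUP i. U i) (x, s) \<partial>count_space (g x)) =
       (SUP i. \<integral>\<^sup>+ s. U i (x, s) \<partial>count_space (g x))" for x
      unfolding SUP_apply using \<open>incseq U\<close>
      by (intro nn_integral_monotone_convergence_SUP) (auto simp: incseq_def le_fun_def)
    then show ?case using seq.IH by (simp add: borel_measurable_SUP)
  qed
  from this[OF f] show ?thesis by simp
qed

lemma measurable_Bex_point [measurable (raw)]:
  fixes g :: "'x \<Rightarrow> 'a::euclidean_space set"
  assumes [measurable]: "g \<in> measurable X config_space" "Measurable.pred (X \<Otimes>\<^sub>M borel) (case_prod P)"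
  shows "Measurable.pred X (\<lambda>x. \<exists>s\<in>g x. P x s)"
proof -
  have "(\<exists>s\<in>g x. P x s) \<longleftrightarrow> (\<integral>\<^sup>+ s. (if P x s then 1 else 0) \<partial>count_space (g x)) \<noteq> (0::ennreal)" for x
    by (subst nn_integral_0_iff_AE) (auto simp: AE_count_space)
  then show ?thesis by simp
qed

lemma measurable_mem_config [measurable (raw)]:
  fixes g :: "'x \<Rightarrow> 'a::euclidean_space set"
  assumes [measurable]: "g \<in> measurable X config_space" "h \<in> borel_measurable X"
  shows "Measurable.pred X (\<lambda>x. h x \<in> g x)"
proof -
  have "Measurable.pred X (\<lambda>x. \<exists>s\<in>g x. s = h x)" by measurable
  then show ?thesis by (simp add: Bex_def)
qed

lemma translate_locally_finite:
  fixes \<omega> :: "'a::real_normed_vector set"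
  assumes "\<omega> \<in> locally_finite_sets"
  shows "translate \<omega> x \<in> locally_finite_sets"
  unfolding locally_finite_sets_def
proof (intro CollectI allI impI)
  fix B :: "'a set" assume "bounded B"
  then have "bounded ((\<lambda>s. x + s) ` B)" by (rule bounded_translation)
  with assms have "finite ((\<lambda>s. s - x) ` (\<omega> \<inter> (\<lambda>s. x + s) ` B))"
    by (simp add: locally_finite_sets_def)
  moreover have "translate \<omega> x \<inter> B \<subseteq> (\<lambda>s. s - x) ` (\<omega> \<inter> (\<lambda>s. x + s) ` B)"
  proof
    fix z assume "z \<in> translate \<omega> x \<inter> B"
    then have "x + z \<in> \<omega> \<inter> (\<lambda>s. x + s) ` B" by (auto simp: translate_def)
    then show "z \<in> (\<lambda>s. s - x) ` (\<omega> \<inter> (\<lambda>s. x + s) ` B)" by (rule rev_image_eqI) simp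
  qed
  ultimately show "finite (translate \<omega> x \<inter> B)" by (rule rev_finite_subset)
qed

lemma measurable_translate [measurable (raw)]:
  fixes g :: "'x \<Rightarrow> 'a::euclidean_space set"
  assumes g [measurable]: "g \<in> measurable X config_space" and [measurable]: "h \<in> borel_measurable X"
  shows "(\<lambda>x. translate (g x) (h x)) \<in> measurable X config_space"
proof (rule measurable_configI)
  show "translate (g x) (h x) \<in> locally_finite_sets" if "x \<in> space X" for x
    using measurable_space[OF g that] by (simp add: translate_locally_finite)
  fix A :: "'a set" assume [measurable]: "A \<in> sets borel"
  have "{x \<in> space X. \<not> (\<exists>s\<in>g x. s - h x \<in> A)} \<in> sets X" by measurable
  also have "{x \<in> space X. \<not> (\<exists>s\<in>g x. s - h x \<in> A)} = {x \<in> space X. translate (g x) (h x) \<inter> A = {}}"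
    by (auto simp: translate_def)
  finally show "{x \<in> space X. translate (g x) (h x) \<inter> A = {}} \<in> sets X" .
qed

lemma insert_locally_finite:
  "\<omega> \<in> locally_finite_sets \<Longrightarrow> insert x \<omega> \<in> locally_finite_sets"
  by (simp add: locally_finite_sets_def Int_insert_left)

lemma measurable_insert_config [measurable (raw)]:
  fixes g :: "'x \<Rightarrow> 'a::euclidean_space set"
  assumes g [measurable]: "g \<in> measurable X config_space" and [measurable]: "h \<in> borel_measurable X"
  shows "(\<lambda>x. insert (h x) (g x)) \<in> measurable X config_space"
proof (rule measurable_configI)
  show "insert (h x) (g x) \<in> locally_finite_sets" if "x \<in> space X" for x
    using measurable_space[OF g that] by (simp add: insert_locally_finite)
  fix A :: "'a set" assume [measurable]: "A \<in> sets borel"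
  have "{x \<in> space X. h x \<notin> A \<and> \<not> (\<exists>s\<in>g x. s \<in> A)} \<in> sets X" by measurable
  also have "{x \<in> space X. h x \<notin> A \<and> \<not> (\<exists>s\<in>g x. s \<in> A)} = {x \<in> space X. insert (h x) (g x) \<inter> A = {}}"
    by auto
  finally show "{x \<in> space X. insert (h x) (g x) \<inter> A = {}} \<in> sets X" .
qed

section \<open>The Mecke equation and mass transport\<close>
lemma Int_stable_void_events:
  "Int_stable {void_event A | A :: 'a::metric_space set. A \<in> sets borel \<and> bounded A}"
proof (rule Int_stableI)
  fix a b :: "'a set set" assume "a \<in> {void_event A | A. A \<in> sets borel \<and> bounded A}"
    "b \<in> {void_event A | A. A \<in> sets borel \<and> bounded A}"
  then obtain A B where "a = void_event A" "b = void_event B" "A \<in> sets borel" "B \<in> sets borel"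
    "bounded A" "bounded B" by auto
  moreover from this have "a \<inter> b = void_event (A \<union> B)" by (auto simp: void_event_def)
  ultimately show "a \<inter> b \<in> {void_event A | A. A \<in> sets borel \<and> bounded A}"
    by (auto intro!: exI[of _ "A \<union> B"])
qed

lemma void_event_empty [simp]: "void_event {} = locally_finite_sets"
  by (simp add: void_event_def)

lemma law_eqI_void:
  fixes \<mu> \<nu> :: "'a::euclidean_space set measure"
  assumes sets: "sets \<mu> = sets config_space" "sets \<nu> = sets config_space"
    and eq: "\<And>A. A \<in> sets borel \<Longrightarrow> bounded A \<Longrightarrow> emeasure \<mu> (void_event A) = emeasure \<nu> (void_event A)"
    and fin: "emeasure \<mu> locally_finite_sets \<noteq> \<infinity>"
  shows "\<mu> = \<nu>"
proof (rule measure_eqI_generator_eq[OF Int_stable_void_events, where \<Omega> = locally_finite_sets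
      and A = "\<lambda>_. void_event {}"])
  show "sets \<mu> = sigma_sets locally_finite_sets {void_event A |A. A \<in> sets borel \<and> bounded A}"
    "sets \<nu> = sigma_sets locally_finite_sets {void_event A |A. A \<in> sets borel \<and> bounded A}"
    by (simp_all only: sets sets_config_space_eq_void)
  show "range (\<lambda>_. void_event {}) \<subseteq> {void_event A |A. A \<in> sets borel \<and> bounded A}"
    by (auto simp del: void_event_empty)
qed (use eq fin in \<open>auto simp: void_event_def\<close>)

lemma borel_generated_by_bounded:
  "sets (borel :: 'a::euclidean_space measure) = sigma_sets UNIV {B. B \<in> sets borel \<and> bounded B}"
proof
  show "sets borel \<subseteq> sigma_sets UNIV {B :: 'a set. B \<in> sets borel \<and> bounded B}"
    unfolding borel_eq_box
    by (subst sets_measure_of) (auto intro!: sigma_sets_mono' simp: bounded_box borel_eq_box[symmetric])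
  show "sigma_sets UNIV {B :: 'a set. B \<in> sets borel \<and> bounded B} \<subseteq> sets borel"
    using sets.sigma_sets_subset[of "{B :: 'a set. B \<in> sets borel \<and> bounded B}" borel] by auto
qed

lemma sets_marked_config:
  "sets ((config_space :: 'a set measure) \<Otimes>\<^sub>M (borel :: 'a::euclidean_space measure)) =
    sigma_sets (locally_finite_sets \<times> UNIV)
      {void_event A \<times> B | (A :: 'a set) (B :: 'a set). A \<in> sets borel \<and> bounded A \<and> B \<in> sets borel \<and> bounded B}"
proof -
  let ?Ea = "{void_event A | A :: 'a set. A \<in> sets borel \<and> bounded A}"
  let ?Eb = "{B :: 'a set. B \<in> sets borel \<and> bounded B}"
  have "sets ((config_space :: 'a set measure) \<Otimes>\<^sub>M (borel :: 'a measure)) =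
    sets (sigma (space config_space \<times> space borel) {a \<times> b | a b. a \<in> ?Ea \<and> b \<in> ?Eb})"
  proof (rule sets_pair_eq[where Ca = "{void_event {}}" and Cb = "range (\<lambda>n::nat. ball 0 (real n))"])
    show "\<Union> (range (\<lambda>n. ball 0 (real n))) = space (borel :: 'a measure)"
      using reals_Archimedean2 by auto
  qed (auto simp: void_event_def sets_config_space_eq_void[unfolded void_event_def]
      borel_generated_by_bounded[symmetric] intro!: exI[of _ "{}"])
  also have "{a \<times> b | a b. a \<in> ?Ea \<and> b \<in> ?Eb} =
      {void_event A \<times> B | A B. A \<in> sets borel \<and> bounded A \<and> B \<in> sets borel \<and> bounded B}"
    by blast
  also have "sets (sigma (space config_space \<times> space borel)
        {void_event A \<times> B | (A :: 'a set) (B :: 'a set). A \<in> sets borel \<and> bounded A \<and> B \<in> sets borel \<and> bounded B}) =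
      sigma_sets (locally_finite_sets \<times> UNIV)
        {void_event A \<times> B | A B. A \<in> sets borel \<and> bounded A \<and> B \<in> sets borel \<and> bounded B}"
    by (subst sets_measure_of) (auto simp: void_event_def)
  finally show ?thesis by simp
qed

lemma nn_integral_count_space_1: "(\<integral>\<^sup>+ x. 1 \<partial>count_space A) = (if finite A then of_nat (card A) else \<infinity>)"
  by simp

lemma measurable_infinite_config [measurable]:
  "Measurable.pred config_space (infinite :: 'a::euclidean_space set \<Rightarrow> bool)"
proof -
  have "Measurable.pred config_space (\<lambda>\<omega> :: 'a set. (\<integral>\<^sup>+ x. 1 \<partial>count_space \<omega>) = (\<infinity> :: ennreal))"
    by measurable
  also have "(\<lambda>\<omega> :: 'a set. (\<integral>\<^sup>+ x. 1 \<partial>count_space \<omega>) = (\<infinity> :: ennreal)) = infinite"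
    unfolding nn_integral_count_space_1 by (auto simp: fun_eq_iff ennreal_of_nat_eq_real_of_nat)
  finally show ?thesis .
qed

lemma ennreal_inverse_antimono: "x \<le> y \<Longrightarrow> inverse y \<le> inverse (x :: ennreal)"
proof (cases "x = 0 \<or> y = top")
  case False
  moreover assume "x \<le> y"
  ultimately show ?thesis
    by (cases x; cases y) (auto simp: inverse_ennreal top_unique intro!: ennreal_leI le_imp_inverse_le)
qed auto

lemma lborel_distr_reflect: "distr lborel borel uminus = (lborel :: 'a::euclidean_space measure)"
proof -
  have "lborel = density (distr lborel borel (\<lambda>x::'a. 0 + (-1) *\<^sub>R x)) (\<lambda>_. ennreal (\<bar>-1\<bar> ^ DIM('a)))"
    by (rule lborel_affine) simp
  also have "\<dots> = distr lborel borel uminus" by (simp add: density_1)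
  finally show ?thesis ..
qed

text \<open>Only two consequences of the definition of a Poisson process enter the argument: void probabilities,
which determine the law, and the mean number of points in \<open>B\<close> on the event that a disjoint set \<open>A\<close> is void,
which determines the Campbell measure.\<close>
locale poisson_law = prob_space \<mu> for \<mu> :: "'a::euclidean_space set measure" +
  fixes lam :: real
  assumes sets_law [measurable_cong]: "sets \<mu> = sets config_space"
    and lam_pos: "lam > 0"
    and void_prob: "A \<in> sets borel \<Longrightarrow> bounded A \<Longrightarrow>
      emeasure \<mu> (void_event A) = ennreal (exp (- (lam * measure lborel A)))"
    and mean_on_void: "A \<in> sets borel \<Longrightarrow> bounded A \<Longrightarrow> B \<in> sets borel \<Longrightarrow> bounded B \<Longrightarrow> A \<inter> B = {} \<Longrightarrow>
      (\<integral>\<^sup>+ \<omega>. of_nat (card (\<omega> \<inter> B)) * indicator (void_event A) \<omega> \<partial>\<mu>) =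
        ennreal (lam * measure lborel B) * emeasure \<mu> (void_event A)"
begin

lemma space_law: "space \<mu> = locally_finite_sets"
  using sets_eq_imp_space_eq[OF sets_law] by simp

lemma stationary: "distr \<mu> config_space (\<lambda>\<omega>. translate \<omega> x) = \<mu>"
proof (rule law_eqI_void)
  fix A :: "'a set" assume A: "A \<in> sets borel" "bounded A"
  define A' where "A' = (\<lambda>s. - x + s) -` A"
  have A': "A' \<in> sets borel" unfolding A'_def
    using measurable_sets[OF _ A(1), of "\<lambda>s. - x + s" borel] by (simp del: add_uminus_conv_diff uminus_add_conv_diff)
  have "A' = (\<lambda>s. x + s) ` A"
    unfolding A'_def by (auto intro: image_eqI[where x = "- x + _"])
  then have "bounded A'" using A(2) bounded_translation by metis
  have "measure lborel A = measure (distr lborel borel ((+) (- x))) A"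
    by (simp add: lborel_distr_plus)
  also have "\<dots> = measure lborel A'"
    using A(1) by (subst measure_distr) (simp_all add: A'_def del: add_uminus_conv_diff uminus_add_conv_diff)
  finally have vol: "measure lborel A' = measure lborel A" ..
  have "emeasure (distr \<mu> config_space (\<lambda>\<omega>. translate \<omega> x)) (void_event A) =
      emeasure \<mu> ((\<lambda>\<omega>. translate \<omega> x) -` void_event A \<inter> space \<mu>)"
    by (rule emeasure_distr) (use void_event_in_config[OF A] in measurable)
  also have "(\<lambda>\<omega>. translate \<omega> x) -` void_event A \<inter> space \<mu> = void_event A'"
    by (auto simp: void_event_def space_law translate_locally_finite A'_def) (auto simp: translate_def)
  also have "emeasure \<mu> (void_event A') = emeasure \<mu> (void_event A)"
    using A A' \<open>bounded A'\<close> by (simp add: void_prob vol)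
  finally show "emeasure (distr \<mu> config_space (\<lambda>\<omega>. translate \<omega> x)) (void_event A) =
    emeasure \<mu> (void_event A)" .
next
  have "(\<lambda>\<omega>. translate \<omega> x) \<in> measurable \<mu> config_space" by measurable
  then interpret P: prob_space "distr \<mu> config_space (\<lambda>\<omega>. translate \<omega> x)"
    by (rule prob_space_distr)
  show "emeasure (distr \<mu> config_space (\<lambda>\<omega>. translate \<omega> x)) locally_finite_sets \<noteq> \<infinity>"
    by simp
qed (auto simp: sets_law)

text \<open>Both sides are integrals of \<open>f\<close> with respect to a measure on configurations with a marked point: \<open>C\<close> marks
a point of the process, \<open>D\<close> adds a point placed according to Lebesgue measure. On a product of a void
event for \<open>A\<close> with a bounded set \<open>B\<close>, marked points can only lie in \<open>B - A\<close>, and both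
measures give \<open>lam * vol (B - A) * P(A void)\<close>. These products form a generator stable under
intersection, so \<open>C = D\<close>.\<close>
lemma Mecke:
  assumes f: "case_prod f \<in> borel_measurable (config_space \<Otimes>\<^sub>M borel)"
  shows "(\<integral>\<^sup>+ \<omega>. \<integral>\<^sup>+ x. f \<omega> x \<partial>count_space \<omega> \<partial>\<mu>) =
    ennreal lam * (\<integral>\<^sup>+ x. \<integral>\<^sup>+ \<omega>. f (insert x \<omega>) x \<partial>\<mu> \<partial>lborel)"
proof -
  let ?K = "(config_space :: 'a set measure) \<Otimes>\<^sub>M (borel :: 'a measure)"
  define c where "c Z = (\<integral>\<^sup>+ \<omega>. \<integral>\<^sup>+ x. indicator Z (\<omega>, x) \<partial>count_space \<omega> \<partial>\<mu>)" for Z :: "('a set \<times> 'a) set"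
  define C where "C = measure_of (space ?K) (sets ?K) c"
  have [measurable]: "(\<lambda>\<omega>. \<integral>\<^sup>+ x. h (\<omega>, x) \<partial>count_space \<omega>) \<in> borel_measurable \<mu>"
    if [measurable]: "h \<in> borel_measurable ?K" for h :: "_ \<Rightarrow> ennreal"
    by (rule measurable_point_sum) measurable
  have sC [measurable_cong]: "sets C = sets ?K" by (simp add: C_def)
  have eC: "emeasure C Z = c Z" if "Z \<in> sets ?K" for Z
    unfolding C_def
  proof (rule emeasure_measure_of_sigma)
    show "countably_additive (sets ?K) c"
    proof (rule countably_additiveI)
      fix Z :: "nat \<Rightarrow> ('a set \<times> 'a) set" assume Z: "range Z \<subseteq> sets ?K" "disjoint_family Z"
      then have [measurable]: "Z i \<in> sets ?K" for i by auto
      have "c (\<Union>i. Z i) = (\<integral>\<^sup>+ \<omega>. \<integral>\<^sup>+ x. (\<Sum>i. indicator (Z i) (\<omega>, x)) \<partial>count_space \<omega> \<partial>\<mu>)"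
        by (simp add: c_def suminf_indicator[OF Z(2)])
      also have "\<dots> = (\<Sum>i. c (Z i))"
        by (simp add: c_def nn_integral_suminf)
      finally show "(\<Sum>i. c (Z i)) = c (\<Union>i. Z i)" ..
    qed
  qed (use that in \<open>auto simp: positive_def c_def sets.sigma_algebra_axioms\<close>)
  have iC: "(\<integral>\<^sup>+ z. h z \<partial>C) = (\<integral>\<^sup>+ \<omega>. \<integral>\<^sup>+ x. h (\<omega>, x) \<partial>count_space \<omega> \<partial>\<mu>)"
    if "h \<in> borel_measurable ?K" for h
    using that
  proof (induction rule: borel_measurable_induct)
    case (cong u v)
    have "(\<integral>\<^sup>+ z. u z \<partial>C) = (\<integral>\<^sup>+ z. v z \<partial>C)"
      using cong(3) sets_eq_imp_space_eq[OF sC] by (intro nn_integral_cong) auto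
    moreover have "(\<integral>\<^sup>+ \<omega>. \<integral>\<^sup>+ x. u (\<omega>, x) \<partial>count_space \<omega> \<partial>\<mu>) = (\<integral>\<^sup>+ \<omega>. \<integral>\<^sup>+ x. v (\<omega>, x) \<partial>count_space \<omega> \<partial>\<mu>)"
      using cong(3) by (intro nn_integral_cong) (auto simp: space_pair_measure space_law)
    ultimately show ?case using cong(4) by simp
  next
    case (set A)
    then show ?case using eC[OF set] by (simp add: sC c_def)
  next
    case (mult u c)
    then show ?case by (simp add: nn_integral_cmult)
  next
    case (add u v)
    then show ?case by (simp add: nn_integral_add)
  next
    case (seq U)
    have inc: "incseq (\<lambda>i \<omega>. \<integral>\<^sup>+ x. U i (\<omega>, x) \<partial>count_space \<omega>)"
      using \<open>incseq U\<close> by (auto simp: incseq_def le_fun_def intro!: nn_integral_mono)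
    have "(\<integral>\<^sup>+ x. (SUP i. U i (\<omega>, x)) \<partial>count_space \<omega>) = (SUP i. \<integral>\<^sup>+ x. U i (\<omega>, x) \<partial>count_space \<omega>)" for \<omega>
      using \<open>incseq U\<close> by (intro nn_integral_monotone_convergence_SUP) (auto simp: incseq_def le_fun_def)
    then have "(\<integral>\<^sup>+ \<omega>. \<integral>\<^sup>+ x. (SUP i. U i (\<omega>, x)) \<partial>count_space \<omega> \<partial>\<mu>) =
        (SUP i. \<integral>\<^sup>+ \<omega>. \<integral>\<^sup>+ x. U i (\<omega>, x) \<partial>count_space \<omega> \<partial>\<mu>)"
      using seq.hyps by (simp add: nn_integral_monotone_convergence_SUP[OF inc])
    moreover have "(\<integral>\<^sup>+ z. (SUP i. U i z) \<partial>C) = (SUP i. \<integral>\<^sup>+ z. U i z \<partial>C)"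
      using seq.hyps by (intro nn_integral_monotone_convergence_SUP) auto
    ultimately show ?case using seq.IH by (simp add: image_comp)
  qed
  define D where "D = scale_measure (ennreal lam) (distr (lborel \<Otimes>\<^sub>M \<mu>) ?K (\<lambda>(x, \<omega>). (insert x \<omega>, x)))"
  have sD [measurable_cong]: "sets D = sets ?K" by (simp add: D_def)
  have iD: "(\<integral>\<^sup>+ z. h z \<partial>D) = ennreal lam * (\<integral>\<^sup>+ x. \<integral>\<^sup>+ \<omega>. h (insert x \<omega>, x) \<partial>\<mu> \<partial>lborel)"
    if [measurable]: "h \<in> borel_measurable ?K" for h
    unfolding D_def
    by (simp add: nn_integral_scale_measure nn_integral_distr nn_integral_fst[symmetric] case_prod_beta)
  have gen: "c (void_event A \<times> B) = ennreal (lam * measure lborel (B - A)) * emeasure \<mu> (void_event A)"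
    if A: "A \<in> sets borel" "bounded A" and B: "B \<in> sets borel" "bounded B" for A B
  proof -
    have "(\<integral>\<^sup>+ x. indicator (void_event A \<times> B) (\<omega>, x) \<partial>count_space \<omega>) =
        of_nat (card (\<omega> \<inter> (B - A))) * indicator (void_event A) \<omega>" if "\<omega> \<in> space \<mu>" for \<omega>
    proof -
      have fin: "finite (\<omega> \<inter> B)" using that B by (simp add: space_law finite_config_Int)
      show ?thesis
      proof (cases "\<omega> \<in> void_event A")
        case True
        then have "\<omega> \<inter> B = \<omega> \<inter> (B - A)" by (auto simp: void_event_def)
        moreover have "(\<integral>\<^sup>+ x. indicator (void_event A \<times> B) (\<omega>, x) \<partial>count_space \<omega>) =
            (\<integral>\<^sup>+ x. indicator B x \<partial>count_space \<omega>)"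
          using True by (intro nn_integral_cong) (auto simp: indicator_def)
        ultimately show ?thesis
          using True nn_integral_count_space_indicator_card[OF fin] by simp
      next
        case False
        then show ?thesis by (simp add: indicator_def)
      qed
    qed
    then have "c (void_event A \<times> B) =
        (\<integral>\<^sup>+ \<omega>. of_nat (card (\<omega> \<inter> (B - A))) * indicator (void_event A) \<omega> \<partial>\<mu>)"
      unfolding c_def by (rule nn_integral_cong)
    also have "\<dots> = ennreal (lam * measure lborel (B - A)) * emeasure \<mu> (void_event A)"
      using A B by (intro mean_on_void) (auto intro: bounded_subset)
    finally show ?thesis .
  qed
  have "C = D"
  proof (rule measure_eqI_generator_eq[where \<Omega> = "locally_finite_sets \<times> UNIV" and
      E = "{void_event A \<times> B | (A :: 'a set) (B :: 'a set). A \<in> sets borel \<and> bounded A \<and> B \<in> sets borel \<and> bounded B}"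
      and A = "\<lambda>n. void_event {} \<times> ball 0 (real n)"])
    let ?E = "{void_event A \<times> B | (A :: 'a set) (B :: 'a set). A \<in> sets borel \<and> bounded A \<and> B \<in> sets borel \<and> bounded B}"
    show "Int_stable ?E"
    proof (rule Int_stableI)
      fix a b assume "a \<in> ?E" "b \<in> ?E"
      then obtain A B A' B' where *: "a = void_event A \<times> B" "b = void_event A' \<times> B'"
        "A \<in> sets borel \<and> bounded A \<and> B \<in> sets borel \<and> bounded B"
        "A' \<in> sets borel \<and> bounded A' \<and> B' \<in> sets borel \<and> bounded B'" by auto
      then have "a \<inter> b = void_event (A \<union> A') \<times> (B \<inter> B')" by (auto simp: void_event_def)
      moreover have "A \<union> A' \<in> sets borel \<and> bounded (A \<union> A') \<and> B \<inter> B' \<in> sets borel \<and> bounded (B \<inter> B')"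
        using * by (auto intro: bounded_subset)
      ultimately show "a \<inter> b \<in> ?E" by blast
    qed
    show "sets C = sigma_sets (locally_finite_sets \<times> UNIV) ?E" "sets D = sigma_sets (locally_finite_sets \<times> UNIV) ?E"
      by (simp_all only: sC sD sets_marked_config)
    fix X assume "X \<in> ?E"
    then obtain A B where AB: "X = void_event A \<times> B" "A \<in> sets borel" "bounded A" "B \<in> sets borel" "bounded B"
      by auto
    note [measurable] = void_event_in_config[OF AB(2,3)] AB(4)
    have X [measurable]: "X \<in> sets ?K" unfolding AB(1) by measurable
    have fin: "emeasure lborel (B - A) \<noteq> \<infinity>"
      using emeasure_bounded_finite[of "B - A"] AB bounded_subset[of B "B - A"] by auto
    have inner: "(\<integral>\<^sup>+ \<omega>. indicator X (insert x \<omega>, x) \<partial>\<mu>) = indicator (B - A) x * emeasure \<mu> (void_event A)" for x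
    proof -
      have "(\<integral>\<^sup>+ \<omega>. indicator X (insert x \<omega>, x) \<partial>\<mu>) = (\<integral>\<^sup>+ \<omega>. indicator (B - A) x * indicator (void_event A) \<omega> \<partial>\<mu>)"
        by (intro nn_integral_cong)
          (auto simp: AB(1) indicator_def void_event_def space_law insert_locally_finite)
      also have "\<dots> = indicator (B - A) x * emeasure \<mu> (void_event A)"
        by (subst nn_integral_cmult) (auto simp: sets_law)
      finally show ?thesis .
    qed
    have "emeasure D X = (\<integral>\<^sup>+ z. indicator X z \<partial>D)" using X by (simp add: sD)
    also have "\<dots> = ennreal lam * (\<integral>\<^sup>+ x. \<integral>\<^sup>+ \<omega>. indicator X (insert x \<omega>, x) \<partial>\<mu> \<partial>lborel)"
      by (rule iD) simp
    also have "\<dots> = ennreal lam * (\<integral>\<^sup>+ x. indicator (B - A) x * emeasure \<mu> (void_event A) \<partial>lborel)"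
      by (simp only: inner)
    also have "(\<integral>\<^sup>+ x. indicator (B - A) x * emeasure \<mu> (void_event A) \<partial>lborel) =
        emeasure lborel (B - A) * emeasure \<mu> (void_event A)"
      using AB by (subst nn_integral_multc) auto
    also have "ennreal lam * (emeasure lborel (B - A) * emeasure \<mu> (void_event A)) =
        ennreal (lam * measure lborel (B - A)) * emeasure \<mu> (void_event A)"
      using fin lam_pos by (simp add: emeasure_eq_ennreal_measure ennreal_mult mult.assoc)
    also have "\<dots> = emeasure C X"
      using gen[OF AB(2-5)] eC[OF X] AB(1) by simp
    finally show "emeasure C X = emeasure D X" ..
  next
    show "range (\<lambda>n. void_event {} \<times> ball 0 (real n)) \<subseteq>
      {void_event A \<times> B | (A :: 'a set) (B :: 'a set). A \<in> sets borel \<and> bounded A \<and> B \<in> sets borel \<and> bounded B}"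
      by (intro image_subsetI CollectI exI conjI, rule refl) auto
    show "(\<Union>n. void_event {} \<times> ball 0 (real n)) = locally_finite_sets \<times> (UNIV :: 'a set)"
      using reals_Archimedean2 by (auto simp: void_event_def)
    fix n :: nat
    have "void_event {} \<times> ball (0 :: 'a) (real n) \<in> sets ((config_space :: 'a set measure) \<Otimes>\<^sub>M borel)"
      by (intro pair_measureI void_event_in_config) auto
    then have "emeasure C (void_event {} \<times> ball 0 (real n)) =
        ennreal (lam * measure lborel (ball (0 :: 'a) (real n) - {})) * emeasure \<mu> (void_event {})"
      using gen[of "{}" "ball 0 (real n)"] by (simp add: eC)
    then show "emeasure C (void_event {} \<times> ball 0 (real n)) \<noteq> \<infinity>"
      by (simp add: ennreal_mult_eq_top_iff)
  qed (auto simp: void_event_def)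
  then show ?thesis using iC[OF f] iD[OF f] by simp
qed

lemma AE_not_mem: "AE \<omega> in \<mu>. x \<notin> \<omega>"
proof -
  have "emeasure \<mu> (void_event {x}) = 1" by (subst void_prob) auto
  then have "AE \<omega> in \<mu>. \<omega> \<in> void_event {x}"
    using void_event_in_config[of "{x}"] by (subst AE_in_set_eq_1) (auto simp: sets_law measure_def)
  then show ?thesis by eventually_elim (auto simp: void_event_def)
qed

text \<open>Giving every point the weight \<open>1 / card \<omega>\<close> makes the left-hand side of the Mecke equation at most
\<open>1\<close>. On the right, adding one point raises the cardinality by at most one, so the spatial integral is at
least that of the constant \<open>E (1 / (card \<omega> + 1))\<close> over all of space; hence this constant vanishes.\<close>
lemma AE_infinite: "AE \<omega> in \<mu>. infinite \<omega>"
proof -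
  define h :: "'a set \<Rightarrow> ennreal" where "h \<omega> = (\<integral>\<^sup>+ x. 1 \<partial>count_space \<omega>)" for \<omega>
  have [measurable]: "h \<in> borel_measurable config_space"
    unfolding h_def by measurable
  have h: "h \<omega> = (if finite \<omega> then of_nat (card \<omega>) else \<infinity>)" for \<omega>
    by (simp add: h_def)
  have "h (insert x \<omega>) \<le> h \<omega> + 1" for x \<omega>
    by (auto simp: h card_insert_if)
  then have le: "inverse (h \<omega> + 1) \<le> inverse (h (insert x \<omega>))" for x \<omega>
    by (rule ennreal_inverse_antimono)
  let ?c = "\<integral>\<^sup>+ \<omega>. inverse (h \<omega> + 1) \<partial>\<mu>"
  have "ennreal lam * (\<integral>\<^sup>+ (x::'a). ?c \<partial>lborel) \<le>
      ennreal lam * (\<integral>\<^sup>+ x. \<integral>\<^sup>+ \<omega>. inverse (h (insert x \<omega>)) \<partial>\<mu> \<partial>lborel)"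
    by (intro mult_left_mono nn_integral_mono le) auto
  also have "\<dots> = (\<integral>\<^sup>+ \<omega>. \<integral>\<^sup>+ x. inverse (h \<omega>) \<partial>count_space \<omega> \<partial>\<mu>)"
    by (rule Mecke[symmetric]) measurable
  also have "\<dots> = (\<integral>\<^sup>+ \<omega>. inverse (h \<omega>) * h \<omega> \<partial>\<mu>)"
    by (simp add: h_def nn_integral_cmult[symmetric])
  also have "\<dots> \<le> (\<integral>\<^sup>+ \<omega>. 1 \<partial>\<mu>)"
  proof (rule nn_integral_mono)
    \<comment> \<open>Equality fails only for the empty and the infinite configuration, where the product is \<open>0\<close>.\<close>
    show "inverse (h \<omega>) * h \<omega> \<le> 1" for \<omega>
    proof (cases "finite \<omega> \<and> \<omega> \<noteq> {}")
      case True
      then have "h \<omega> \<noteq> 0" "h \<omega> < top"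
        by (auto simp: h) (simp add: ennreal_of_nat_eq_real_of_nat)
      then show ?thesis by (simp add: divide_ennreal_def[symmetric] mult.commute[of "inverse _"])
    qed (auto simp: h)
  qed
  finally have "ennreal lam * (?c * \<infinity>) \<le> 1"
    by (simp add: emeasure_space_1)
  then have "?c = 0"
    using lam_pos by (auto simp: ennreal_mult_top top_unique split: if_splits)
  then have "AE \<omega> in \<mu>. inverse (h \<omega> + 1) = 0"
    by (subst (asm) nn_integral_0_iff_AE) auto
  then show ?thesis by eventually_elim (auto simp: h split: if_splits)
qed

definition palm :: "'a set measure" where
  "palm = distr \<mu> config_space (insert 0)"

lemma sets_palm [measurable_cong]: "sets palm = sets config_space"
  by (simp add: palm_def)

lemma palm_Mecke:
  assumes [measurable]: "case_prod f \<in> borel_measurable (config_space \<Otimes>\<^sub>M borel)"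
    and 0: "\<And>\<omega>. f \<omega> 0 = 0"
  shows "(\<integral>\<^sup>+ \<omega>. \<integral>\<^sup>+ x. f \<omega> x \<partial>count_space \<omega> \<partial>palm) =
    ennreal lam * (\<integral>\<^sup>+ x. \<integral>\<^sup>+ \<omega>. f (insert 0 (insert x \<omega>)) x \<partial>\<mu> \<partial>lborel)"
proof -
  have "(\<integral>\<^sup>+ \<omega>. \<integral>\<^sup>+ x. f \<omega> x \<partial>count_space \<omega> \<partial>palm) =
      (\<integral>\<^sup>+ \<omega>. \<integral>\<^sup>+ x. f (insert 0 \<omega>) x \<partial>count_space (insert 0 \<omega>) \<partial>\<mu>)"
    unfolding palm_def by (rule nn_integral_distr) measurable
  also have "\<dots> = (\<integral>\<^sup>+ \<omega>. \<integral>\<^sup>+ x. f (insert 0 \<omega>) x \<partial>count_space \<omega> \<partial>\<mu>)"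
    by (intro nn_integral_cong nn_integral_count_space_eq) (auto simp: 0)
  also have "\<dots> = ennreal lam * (\<integral>\<^sup>+ x. \<integral>\<^sup>+ \<omega>. f (insert 0 (insert x \<omega>)) x \<partial>\<mu> \<partial>lborel)"
    by (rule Mecke) measurable
  finally show ?thesis .
qed

text \<open>Mass transport: if \<open>f \<omega> x\<close> is the mass that the point at the origin sends to the point \<open>x\<close>, the right-hand
side is the mass it receives, and the two have the same mean. By the Mecke equation both sides are
integrals over the position \<open>x\<close> of a second added point; moving the origin to \<open>x\<close>
leaves the law of the other points unchanged and replaces \<open>x\<close> by \<open>- x\<close>. The condition at \<open>0\<close> excludes the
mass that the origin sends to itself, where no second point is added.\<close>
lemma exchange:
  assumes [measurable]: "case_prod f \<in> borel_measurable (config_space \<Otimes>\<^sub>M borel)"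
    and 0: "\<And>\<omega>. f \<omega> 0 = 0"
  shows "(\<integral>\<^sup>+ \<omega>. \<integral>\<^sup>+ x. f \<omega> x \<partial>count_space \<omega> \<partial>palm) =
    (\<integral>\<^sup>+ \<omega>. \<integral>\<^sup>+ x. f (translate \<omega> x) (- x) \<partial>count_space \<omega> \<partial>palm)"
proof -
  define F where "F x = (\<integral>\<^sup>+ \<omega>. f (insert 0 (insert x \<omega>)) x \<partial>\<mu>)" for x
  have [measurable]: "F \<in> borel_measurable borel"
    unfolding F_def by measurable
  have shifted: "(\<integral>\<^sup>+ \<omega>. f (translate (insert 0 (insert x \<omega>)) x) (- x) \<partial>\<mu>) = F (- x)" for x
  proof -
    have "F (- x) = (\<integral>\<^sup>+ \<omega>. f (insert 0 (insert (- x) \<omega>)) (- x) \<partial>distr \<mu> config_space (\<lambda>\<omega>. translate \<omega> x))"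
      by (simp add: stationary F_def)
    also have "\<dots> = (\<integral>\<^sup>+ \<omega>. f (insert 0 (insert (- x) (translate \<omega> x))) (- x) \<partial>\<mu>)"
      by (rule nn_integral_distr) measurable
    finally show ?thesis by (simp add: translate_def insert_commute)
  qed
  have "(\<integral>\<^sup>+ \<omega>. \<integral>\<^sup>+ x. f (translate \<omega> x) (- x) \<partial>count_space \<omega> \<partial>palm) =
      ennreal lam * (\<integral>\<^sup>+ x. \<integral>\<^sup>+ \<omega>. f (translate (insert 0 (insert x \<omega>)) x) (- x) \<partial>\<mu> \<partial>lborel)"
    by (rule palm_Mecke) (measurable, simp add: 0)
  also have "\<dots> = ennreal lam * (\<integral>\<^sup>+ x. F (- x) \<partial>lborel)"
    by (simp only: shifted)
  also have "(\<integral>\<^sup>+ x. F (- x) \<partial>lborel) = (\<integral>\<^sup>+ x. F x \<partial>distr lborel borel uminus)"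
    by (rule nn_integral_distr[symmetric]) measurable
  also have "\<dots> = (\<integral>\<^sup>+ x. F x \<partial>lborel)" by (simp only: lborel_distr_reflect)
  finally show ?thesis
    unfolding F_def using palm_Mecke[OF assms] by simp
qed

end

section \<open>A translation-covariant matching\<close>
lemma translate_0 [simp]: "translate \<omega> 0 = \<omega>"
  by (simp add: translate_def)

lemma translate_translate [simp]: "translate (translate \<omega> x) y = translate \<omega> (x + y)"
  by (auto simp: translate_def image_image diff_diff_eq)

lemma mem_translate_iff: "y \<in> translate \<omega> x \<longleftrightarrow> y + x \<in> \<omega>"
  by (force simp: translate_def)

definition sole_point :: "'a::zero set \<Rightarrow> 'a set \<Rightarrow> 'a" where
  "sole_point C \<omega> = (if is_singleton (\<omega> \<inter> C) then the_elem (\<omega> \<inter> C) else 0)"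

text \<open>The origin and \<open>x\<close> propose to each other when each is the only point that the other one sees through
the window \<open>C\<close>; a configuration without such an \<open>x\<close> has candidate \<open>0\<close>.\<close>
definition candidate :: "'a::ab_group_add set \<Rightarrow> 'a set \<Rightarrow> 'a" where
  "candidate C \<omega> =
    (let x = sole_point C \<omega> in if sole_point C (translate \<omega> x) = - x then x else 0)"

text \<open>The relative position of the partner that the origin has after the first \<open>n\<close> rounds, or \<open>0\<close> if it is
still single. The state of any other point \<open>x\<close> is the value at \<open>translate \<omega> x\<close>; thus a
round matches the origin with its candidate when both are single.\<close>
fun partner_by :: "(nat \<Rightarrow> 'a::ab_group_add set) \<Rightarrow> nat \<Rightarrow> 'a set \<Rightarrow> 'a" where
  "partner_by C 0 \<omega> = 0"
| "partner_by C (Suc n) \<omega> =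
    (if partner_by C n \<omega> \<noteq> 0 then partner_by C n \<omega>
     else if partner_by C n (translate \<omega> (candidate (C n) \<omega>)) = 0 then candidate (C n) \<omega>
     else 0)"

text \<open>The sequence changes its value at most once, from \<open>0\<close> to the final partner, so the limit exists; as
a limit it is measurable.\<close>
definition partner :: "(nat \<Rightarrow> 'a::real_normed_vector set) \<Rightarrow> 'a set \<Rightarrow> 'a" where
  "partner C \<omega> = lim (\<lambda>n. partner_by C n \<omega>)"

lemma sole_point_eq: "\<omega> \<inter> C = {x} \<Longrightarrow> sole_point C \<omega> = x"
  unfolding sole_point_def by (simp only: is_singletonI the_elem_eq if_True)

lemma sole_point_mem: "sole_point C \<omega> \<in> insert 0 \<omega>"
proof (cases "is_singleton (\<omega> \<inter> C)")
  case True
  then obtain x where "\<omega> \<inter> C = {x}" by (rule is_singletonE)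
  then show ?thesis using sole_point_eq[of \<omega> C x] by blast
qed (simp add: sole_point_def)

lemma candidate_mem: "candidate C \<omega> \<in> insert 0 \<omega>"
  unfolding candidate_def Let_def using sole_point_mem[of C \<omega>] by (simp only: split: if_split) simp

lemma candidate_translate: "candidate C (translate \<omega> (candidate C \<omega>)) = - candidate C \<omega>"
proof -
  define x where "x = sole_point C \<omega>"
  show ?thesis
  proof (cases "sole_point C (translate \<omega> x) = - x")
    case True
    then have "candidate C \<omega> = x" "candidate C (translate \<omega> x) = - x"
      by (simp_all add: candidate_def x_def[symmetric])
    then show ?thesis by simp
  next
    case False
    then have "candidate C \<omega> = 0" by (simp add: candidate_def x_def[symmetric])
    then show ?thesis by simp
  qed
qed

lemma partner_by_mem: "partner_by C n \<omega> \<in> insert 0 \<omega>"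
proof (induction n)
  case (Suc n)
  then show ?case using candidate_mem[of "C n" \<omega>] by auto
qed simp

lemma partner_by_translate: "partner_by C n (translate \<omega> (partner_by C n \<omega>)) = - partner_by C n \<omega>"
proof (induction n)
  case (Suc n)
  define x where "x = candidate (C n) \<omega>"
  consider "partner_by C n \<omega> \<noteq> 0" | "partner_by C n \<omega> = 0" "partner_by C n (translate \<omega> x) = 0"
    | "partner_by C n \<omega> = 0" "partner_by C n (translate \<omega> x) \<noteq> 0" by blast
  then show ?case
  proof cases
    case 1
    then show ?thesis using Suc by simp
  next
    case 2
    moreover have "candidate (C n) (translate \<omega> x) = - x"
      unfolding x_def by (rule candidate_translate)
    ultimately show ?thesis by (simp add: x_def[symmetric])
  next
    case 3
    then show ?thesis by (simp add: x_def[symmetric])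
  qed
qed simp

lemma partner_by_stable: "partner_by C n \<omega> \<noteq> 0 \<Longrightarrow> n \<le> m \<Longrightarrow> partner_by C m \<omega> = partner_by C n \<omega>"
proof (induction m)
  case (Suc m)
  show ?case
  proof (cases "n \<le> m")
    case True
    then show ?thesis using Suc by simp
  next
    case False
    then have "n = Suc m" using Suc.prems(2) by simp
    then show ?thesis by simp
  qed
qed simp

lemma partner_eq:
  assumes "partner_by C n \<omega> \<noteq> 0"
  shows "partner C \<omega> = partner_by C n \<omega>"
  unfolding partner_def
  by (rule limI, rule tendsto_eventually)
    (auto simp: eventually_sequentially intro!: exI[of _ n] partner_by_stable assms)

lemma partner_cases:
  obtains (unmatched) "partner C \<omega> = 0" "\<And>n. partner_by C n \<omega> = 0"
  | (matched) n where "partner C \<omega> = partner_by C n \<omega>" "partner_by C n \<omega> \<noteq> 0"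
proof (cases "\<exists>n. partner_by C n \<omega> \<noteq> 0")
  case True
  then show ?thesis using partner_eq matched by metis
next
  case False
  then show ?thesis using unmatched by (simp add: partner_def)
qed

text \<open>Being partners is a symmetric relation: seen from the partner of the origin, the partner is the origin.\<close>
lemma partner_translate: "partner C (translate \<omega> (partner C \<omega>)) = - partner C \<omega>"
proof (cases C \<omega> rule: partner_cases)
  case (matched n)
  then show ?thesis
    using partner_by_translate[of C n \<omega>] partner_eq[of C n "translate \<omega> (partner_by C n \<omega>)"] by simp
qed simp

lemma partner_mem: "0 \<in> \<omega> \<Longrightarrow> partner C \<omega> \<in> \<omega>"
  using partner_by_mem[of C _ \<omega>] by (cases C \<omega> rule: partner_cases) auto

lemma partner_symmetric: "partner C (translate \<omega> x) = - x \<longleftrightarrow> partner C \<omega> = x"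
proof
  assume "partner C (translate \<omega> x) = - x"
  then show "partner C \<omega> = x" using partner_translate[of C "translate \<omega> x"] by simp
next
  assume "partner C \<omega> = x"
  then show "partner C (translate \<omega> x) = - x" using partner_translate[of C \<omega>] by simp
qed

lemma one_of_pair_matched:
  assumes "\<omega> \<inter> C n = {x}" "translate \<omega> x \<inter> C n = {- x}" "x \<noteq> 0"
  shows "partner C \<omega> \<noteq> 0 \<or> partner C (translate \<omega> x) \<noteq> 0"
proof (rule ccontr)
  assume "\<not> ?thesis"
  then have 0: "partner_by C m \<omega> = 0" "partner_by C m (translate \<omega> x) = 0" for m
    using partner_eq by metis+
  have "candidate (C n) \<omega> = x"
    using sole_point_eq[OF assms(1)] sole_point_eq[OF assms(2)] by (simp add: candidate_def)
  then have "partner_by C (Suc n) \<omega> = x" using 0 by simp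
  then show False using 0 assms(3) by metis
qed

lemma measurable_sole_point [measurable]:
  fixes C :: "'a::euclidean_space set"
  assumes [measurable]: "C \<in> sets borel"
  shows "sole_point C \<in> borel_measurable config_space"
proof (rule measurableI)
  fix A :: "'a set" assume [measurable]: "A \<in> sets borel"
  have *: "sole_point C \<omega> \<in> A \<longleftrightarrow>
      (\<exists>s\<in>\<omega>. s \<in> C \<and> s \<in> A \<and> \<not> (\<exists>t\<in>\<omega>. t \<in> C \<and> t \<noteq> s)) \<or>
      0 \<in> A \<and> \<not> (\<exists>s\<in>\<omega>. s \<in> C \<and> \<not> (\<exists>t\<in>\<omega>. t \<in> C \<and> t \<noteq> s))" for \<omega>
  proof (cases "is_singleton (\<omega> \<inter> C)")
    case True
    then obtain x where "\<omega> \<inter> C = {x}" by (auto elim: is_singletonE)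
    then show ?thesis using sole_point_eq[of \<omega> C x] by blast
  next
    case False
    then have "\<not> (\<exists>s\<in>\<omega>. s \<in> C \<and> \<not> (\<exists>t\<in>\<omega>. t \<in> C \<and> t \<noteq> s))"
      by (auto simp: is_singleton_def)
    then show ?thesis using False by (auto simp: sole_point_def)
  qed
  have "{\<omega> \<in> space config_space. (\<exists>s\<in>\<omega>. s \<in> C \<and> s \<in> A \<and> \<not> (\<exists>t\<in>\<omega>. t \<in> C \<and> t \<noteq> s)) \<or>
      0 \<in> A \<and> \<not> (\<exists>s\<in>\<omega>. s \<in> C \<and> \<not> (\<exists>t\<in>\<omega>. t \<in> C \<and> t \<noteq> s))} \<in> sets config_space"
    by measurable
  then show "sole_point C -` A \<inter> space config_space \<in> sets config_space"
    by (simp add: * vimage_def Int_def conj_commute)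
qed simp

lemma measurable_candidate [measurable]:
  fixes C :: "'a::euclidean_space set"
  assumes [measurable]: "C \<in> sets borel"
  shows "candidate C \<in> borel_measurable config_space"
  unfolding candidate_def Let_def by measurable

lemma measurable_partner_by:
  fixes C :: "nat \<Rightarrow> 'a::euclidean_space set"
  assumes [measurable]: "\<And>n. C n \<in> sets borel"
  shows "partner_by C n \<in> borel_measurable config_space"
proof (induction n)
  case (Suc n)
  note [measurable] = Suc
  show ?case unfolding partner_by.simps by measurable
qed simp

lemma measurable_partner:
  fixes C :: "nat \<Rightarrow> 'a::euclidean_space set"
  assumes "\<And>n. C n \<in> sets borel"
  shows "partner C \<in> borel_measurable config_space"
  unfolding partner_def using measurable_partner_by[OF assms] by (rule borel_measurable_lim_metric)

text \<open>A window in which both members of a pair are to propose in the same round must contain \<open>x\<close> and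
\<open>- x\<close>. It can then isolate the pair only if \<open>- x \<notin> \<omega>\<close> and \<open>x \<notin> \<omega>'\<close>; seen from the two members,
these conditions exclude three points in arithmetic progression.\<close>
definition separating :: "(nat \<Rightarrow> 'a::real_normed_vector set) \<Rightarrow> bool" where
  "separating C \<longleftrightarrow> (\<forall>\<omega>\<in>locally_finite_sets. \<forall>\<omega>'\<in>locally_finite_sets. \<forall>x.
     x \<in> \<omega> \<and> - x \<notin> \<omega> \<and> - x \<in> \<omega>' \<and> x \<notin> \<omega>' \<longrightarrow> (\<exists>n. \<omega> \<inter> C n = {x} \<and> \<omega>' \<inter> C n = {- x}))"

lemma ex_separating:
  obtains C :: "nat \<Rightarrow> 'a::euclidean_space set" where "\<And>n. C n \<in> sets borel" "separating C"
proof -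
  obtain \<B> :: "'a set set" where \<B>: "countable \<B>" "topological_basis \<B>"
    using ex_countable_basis by blast
  define b where "b = from_nat_into \<B>"
  \<comment> \<open>Windows symmetric about the origin, enumerating a countable basis.\<close>
  define C where "C n = b n \<union> uminus -` b n" for n
  have ne: "\<B> \<noteq> {}" using topological_basisE[OF \<B>(2) open_UNIV UNIV_I] by blast
  then have "b n \<in> \<B>" for n by (simp add: b_def from_nat_into)
  then have "open (b n)" for n using topological_basis_open[OF \<B>(2)] by blast
  then have "open (C n)" for n
    unfolding C_def by (intro open_Un open_vimage) (auto intro: continuous_intros)
  then have 1: "C n \<in> sets borel" for n by simp
  have "\<exists>n. \<omega> \<inter> C n = {x} \<and> \<omega>' \<inter> C n = {- x}"
    if \<omega>: "\<omega> \<in> locally_finite_sets" "\<omega>' \<in> locally_finite_sets"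
      and x: "x \<in> \<omega>" "- x \<notin> \<omega>" "- x \<in> \<omega>'" "x \<notin> \<omega>'" for \<omega> \<omega>' x
  proof -
    define Y where "Y = (\<omega> \<union> \<omega>') \<inter> (ball x 1 \<union> ball (- x) 1)"
    have "finite Y"
      using \<omega> by (auto simp: Y_def Int_Un_distrib2 intro!: finite_config_Int)
    \<comment> \<open>\<open>U\<close> is so small that \<open>U \<union> - U\<close> contains no points of the configurations other than \<open>x\<close> and \<open>- x\<close>.\<close>
    define U where "U = ball x 1 - (Y \<union> uminus ` Y - {x})"
    have "open U" unfolding U_def
      using \<open>finite Y\<close> by (intro open_Diff) (auto intro: finite_imp_closed)
    moreover have "x \<in> U" by (simp add: U_def)
    ultimately obtain b' where b': "b' \<in> \<B>" "x \<in> b'" "b' \<subseteq> U"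
      using topological_basisE[OF \<B>(2)] by metis
    then obtain n where n: "b n = b'"
      using \<B>(1) by (metis b_def from_nat_into_surj)
    have "z = x" if "z \<in> \<omega> \<union> \<omega>'" "z \<in> b'" for z
      using that b'(3) by (auto simp: U_def Y_def)
    moreover have "z = - x" if "z \<in> \<omega> \<union> \<omega>'" "- z \<in> b'" for z
    proof -
      have "- z \<in> U" using that(2) b'(3) by blast
      moreover have "dist (- x) z = dist x (- z)" by (metis dist_minus minus_minus)
      with \<open>- z \<in> U\<close> have "z \<in> Y" using that(1) by (auto simp: U_def Y_def)
      ultimately have "- z = x" by (auto simp: U_def)
      then show ?thesis by auto
    qed
    ultimately have "\<omega> \<inter> C n = {x}" "\<omega>' \<inter> C n = {- x}"
      using x b'(2) by (auto simp: C_def n)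
    then show ?thesis by blast
  qed
  then have "separating C" unfolding separating_def by blast
  with 1 show ?thesis by (rule that)
qed

definition no_symmetric_pair :: "'a::real_normed_vector set \<Rightarrow> bool" where
  "no_symmetric_pair \<omega> \<longleftrightarrow> (\<forall>x\<in>\<omega>. x \<noteq> 0 \<longrightarrow> - x \<notin> \<omega>)"

lemma measurable_no_symmetric_pair [measurable]:
  "Measurable.pred config_space (no_symmetric_pair :: 'a::euclidean_space set \<Rightarrow> bool)"
proof -
  have "Measurable.pred config_space (\<lambda>\<omega> :: 'a set. \<not> (\<exists>x\<in>\<omega>. x \<noteq> 0 \<and> - x \<in> \<omega>))"
    by measurable
  also have "(\<lambda>\<omega> :: 'a set. \<not> (\<exists>x\<in>\<omega>. x \<noteq> 0 \<and> - x \<in> \<omega>)) = no_symmetric_pair"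
    by (auto simp: fun_eq_iff no_symmetric_pair_def)
  finally show ?thesis .
qed

text \<open>If two points were never matched, some window would isolate them from each other's point of view, and
they would have been matched in that round at the latest.\<close>
lemma no_two_unmatched:
  fixes C :: "nat \<Rightarrow> 'a::real_normed_vector set"
  assumes "separating C" and \<omega>: "\<omega> \<in> locally_finite_sets"
    and xy: "x \<in> \<omega>" "y \<in> \<omega>" "partner C (translate \<omega> x) = 0" "partner C (translate \<omega> y) = 0"
    and nosym: "\<And>z. z \<in> \<omega> \<Longrightarrow> no_symmetric_pair (translate \<omega> z)"
  shows "x = y"
proof (rule ccontr)
  assume "x \<noteq> y"
  define v where "v = y - x"
  have v: "v \<noteq> 0" "translate (translate \<omega> x) v = translate \<omega> y"
    using \<open>x \<noteq> y\<close> by (auto simp: v_def)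
  have mem: "v \<in> translate \<omega> x" "- v \<in> translate \<omega> y"
    using xy(1,2) by (auto simp: mem_translate_iff v_def)
  moreover from this have "- v \<notin> translate \<omega> x"
    using nosym[OF xy(1)] v(1) unfolding no_symmetric_pair_def by blast
  moreover have "- (- v) \<notin> translate \<omega> y"
    using nosym[OF xy(2)] mem(2) v(1) neg_equal_0_iff_equal unfolding no_symmetric_pair_def by blast
  then have "v \<notin> translate \<omega> y" by simp
  ultimately obtain n where "translate \<omega> x \<inter> C n = {v}" "translate \<omega> y \<inter> C n = {- v}"
    using assms(1) translate_locally_finite[OF \<omega>] unfolding separating_def by blast
  then have "partner C (translate \<omega> x) \<noteq> 0 \<or> partner C (translate \<omega> y) \<noteq> 0"
    using one_of_pair_matched[of "translate \<omega> x" C n v] v by simp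
  then show False using xy by simp
qed

section \<open>Matching the points of a Poisson process\<close>
context poisson_law
begin

lemma prob_space_palm: "prob_space palm"
  unfolding palm_def by (rule prob_space_distr) measurable

lemma AE_palm_zero_mem: "AE \<omega> in palm. 0 \<in> \<omega>"
proof -
  have "Measurable.pred config_space (\<lambda>\<omega> :: 'a set. 0 \<in> \<omega>)" by measurable
  moreover have m: "insert 0 \<in> measurable \<mu> config_space" by measurable
  ultimately show ?thesis
    unfolding palm_def by (subst AE_distr_iff[OF m]) (simp_all add: pred_def)
qed

lemma AE_palm_infinite: "AE \<omega> in palm. infinite \<omega>"
  unfolding palm_def by (subst AE_distr_iff, measurable, measurable, simp add: AE_infinite)

text \<open>By mass transport, what holds almost surely at the origin holds almost surely at all points
simultaneously: the expected number of exceptional points equals the mean of a sum that vanishes unless the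
origin is exceptional.\<close>
lemma AE_palm_translates:
  assumes [measurable]: "Measurable.pred config_space P" and P: "AE \<omega> in palm. P \<omega>"
  shows "AE \<omega> in palm. \<forall>x\<in>\<omega>. P (translate \<omega> x)"
proof -
  define f :: "'a set \<Rightarrow> 'a \<Rightarrow> ennreal" where
    "f \<omega> x = (if x \<noteq> 0 \<and> \<not> P (translate \<omega> x) then 1 else 0)" for \<omega> x
  have [measurable]: "case_prod f \<in> borel_measurable (config_space \<Otimes>\<^sub>M borel)"
    unfolding f_def by measurable
  have "(\<integral>\<^sup>+ \<omega>. \<integral>\<^sup>+ x. f \<omega> x \<partial>count_space \<omega> \<partial>palm) =
      (\<integral>\<^sup>+ \<omega>. \<integral>\<^sup>+ x. f (translate \<omega> x) (- x) \<partial>count_space \<omega> \<partial>palm)"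
    by (rule exchange) (measurable, simp add: f_def)
  also have "\<dots> = (\<integral>\<^sup>+ \<omega>. 0 \<partial>palm)"
    using P by (intro nn_integral_cong_AE) (auto elim!: eventually_mono simp: f_def)
  also have "\<dots> = 0" by simp
  finally have "AE \<omega> in palm. (\<integral>\<^sup>+ x. f \<omega> x \<partial>count_space \<omega>) = 0"
    by (subst (asm) nn_integral_0_iff_AE) auto
  with P show ?thesis
  proof eventually_elim
    case (elim \<omega>)
    then have "\<forall>x\<in>\<omega>. f \<omega> x = 0"
      by (subst (asm) nn_integral_0_iff_AE) (auto simp: AE_count_space)
    then show ?case using elim(1) by (metis f_def translate_0 zero_neq_one)
  qed
qed

text \<open>By the Mecke equation, the expected number of points with a mirror image is an integral over the
probabilities that the process hits the fixed point \<open>- x\<close>, which are zero.\<close>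
lemma AE_palm_no_symmetric_pair: "AE \<omega> in palm. no_symmetric_pair \<omega>"
proof -
  define f :: "'a set \<Rightarrow> 'a \<Rightarrow> ennreal" where
    "f \<omega> x = (if x \<noteq> 0 \<and> - x \<in> \<omega> then 1 else 0)" for \<omega> x
  have [measurable]: "case_prod f \<in> borel_measurable (config_space \<Otimes>\<^sub>M borel)"
    unfolding f_def by measurable
  have null: "(\<integral>\<^sup>+ \<omega>. f (insert 0 (insert x \<omega>)) x \<partial>\<mu>) = 0" for x
  proof -
    have "- x \<noteq> x" if "x \<noteq> 0"
    proof
      assume "- x = x"
      then have "2 *\<^sub>R x = 0" by (metis add.right_inverse scaleR_2)
      then show False using that by simp
    qed
    then have "(\<integral>\<^sup>+ \<omega>. f (insert 0 (insert x \<omega>)) x \<partial>\<mu>) = (\<integral>\<^sup>+ \<omega>. 0 \<partial>\<mu>)"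
      using AE_not_mem[of "- x"]
      by (intro nn_integral_cong_AE) (auto elim!: eventually_mono simp: f_def)
    then show ?thesis by simp
  qed
  have "(\<integral>\<^sup>+ \<omega>. \<integral>\<^sup>+ x. f \<omega> x \<partial>count_space \<omega> \<partial>palm) =
      ennreal lam * (\<integral>\<^sup>+ x. \<integral>\<^sup>+ \<omega>. f (insert 0 (insert x \<omega>)) x \<partial>\<mu> \<partial>lborel)"
    by (rule palm_Mecke) (measurable, simp add: f_def)
  also have "\<dots> = 0" by (simp add: null)
  finally have "AE \<omega> in palm. (\<integral>\<^sup>+ x. f \<omega> x \<partial>count_space \<omega>) = 0"
    by (subst (asm) nn_integral_0_iff_AE) auto
  then show ?thesis
  proof eventually_elim
    case (elim \<omega>)
    then have "\<forall>x\<in>\<omega>. f \<omega> x = 0"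
      by (subst (asm) nn_integral_0_iff_AE) (auto simp: AE_count_space)
    then show ?case by (auto simp: f_def no_symmetric_pair_def split: if_splits)
  qed
qed

text \<open>Let every point send unit mass to each unmatched point other than itself. As there is at most one such
point, the mean of the mass sent is at most \<open>1\<close>; but an unmatched origin would receive mass
from infinitely many points. Hence the origin is almost surely matched.\<close>
lemma AE_palm_matched:
  assumes C: "\<And>n. C n \<in> sets borel" "separating C"
  shows "AE \<omega> in palm. partner C \<omega> \<noteq> 0"
proof -
  note [measurable] = measurable_partner[OF C(1)]
  define f :: "'a set \<Rightarrow> 'a \<Rightarrow> ennreal" where
    "f \<omega> x = (if x \<noteq> 0 \<and> partner C (translate \<omega> x) = 0 then 1 else 0)" for \<omega> x
  have [measurable]: "case_prod f \<in> borel_measurable (config_space \<Otimes>\<^sub>M borel)"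
    unfolding f_def by measurable
  interpret P: prob_space palm by (rule prob_space_palm)
  let ?u = "\<lambda>\<omega>. if partner C \<omega> = 0 then 1 else 0 :: ennreal"
  have "(\<integral>\<^sup>+ \<omega>. ?u \<omega> \<partial>palm) * \<infinity> = (\<integral>\<^sup>+ \<omega>. ?u \<omega> * \<infinity> \<partial>palm)"
    by (rule nn_integral_multc[symmetric]) measurable
  also have "\<dots> = (\<integral>\<^sup>+ \<omega>. \<integral>\<^sup>+ x. f (translate \<omega> x) (- x) \<partial>count_space \<omega> \<partial>palm)"
  proof (rule nn_integral_cong_AE, use AE_palm_infinite in eventually_elim)
    case (elim \<omega>)
    have "(\<integral>\<^sup>+ x. f (translate \<omega> x) (- x) \<partial>count_space \<omega>) =
        (\<integral>\<^sup>+ x. ?u \<omega> * indicator (- {0}) x \<partial>count_space \<omega>)"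
      by (intro nn_integral_cong) (auto simp: f_def)
    also have "\<dots> = ?u \<omega> * (\<integral>\<^sup>+ x. indicator (- {0}) x \<partial>count_space \<omega>)"
      by (rule nn_integral_cmult) simp
    also have "(\<integral>\<^sup>+ x. indicator (- {0}) x \<partial>count_space \<omega>) =
        (\<integral>\<^sup>+ x. indicator (- {0}) x \<partial>count_space (\<omega> - {0}))"
      by (rule nn_integral_count_space_eq) auto
    also have "\<dots> = (\<integral>\<^sup>+ x. 1 \<partial>count_space (\<omega> - {0}))"
      by (intro nn_integral_cong) auto
    also have "\<dots> = \<infinity>" using elim by simp
    finally show ?case ..
  qed
  also have "\<dots> = (\<integral>\<^sup>+ \<omega>. \<integral>\<^sup>+ x. f \<omega> x \<partial>count_space \<omega> \<partial>palm)"
    by (rule exchange[symmetric]) (measurable, simp add: f_def)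
  also have "\<dots> \<le> (\<integral>\<^sup>+ \<omega>. 1 \<partial>palm)"
  proof (rule nn_integral_mono_AE,
      use AE_palm_translates[OF measurable_no_symmetric_pair AE_palm_no_symmetric_pair] AE_space
      in eventually_elim)
    case (elim \<omega>)
    then have \<omega>: "\<omega> \<in> locally_finite_sets" using sets_eq_imp_space_eq[OF sets_palm] by simp
    show ?case
    proof (cases "\<exists>y\<in>\<omega>. partner C (translate \<omega> y) = 0")
      case True
      then obtain y where y: "y \<in> \<omega>" "partner C (translate \<omega> y) = 0" by blast
      have "(\<integral>\<^sup>+ x. f \<omega> x \<partial>count_space \<omega>) \<le> (\<integral>\<^sup>+ x. indicator {y} x \<partial>count_space \<omega>)"
        using no_two_unmatched[OF C(2) \<omega> _ y(1) _ y(2)] elim(1)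
        by (intro nn_integral_mono) (auto simp: f_def indicator_def)
      also have "\<dots> = 1" using y(1) by (simp add: nn_integral_count_space_indicator_card)
      finally show ?thesis .
    next
      case False
      then have "(\<integral>\<^sup>+ x. f \<omega> x \<partial>count_space \<omega>) = (\<integral>\<^sup>+ x. 0 \<partial>count_space \<omega>)"
        by (intro nn_integral_cong) (auto simp: f_def)
      then show ?thesis by simp
    qed
  qed
  finally have "(\<integral>\<^sup>+ \<omega>. ?u \<omega> \<partial>palm) = 0"
    by (auto simp: P.emeasure_space_1 ennreal_mult_top top_unique split: if_splits)
  then have "AE \<omega> in palm. ?u \<omega> = 0"
    by (subst (asm) nn_integral_0_iff_AE) auto
  then show ?thesis by eventually_elim (auto split: if_splits)
qed

text \<open>The origin sends mass to its partner only, and by symmetry it receives mass from its partner only. Mass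
transport therefore identifies the law seen from the partner with the law seen from the origin.\<close>
lemma palm_shift_to_partner:
  assumes C: "\<And>n. C n \<in> sets borel" "separating C"
  shows "distr palm config_space (\<lambda>\<omega>. translate \<omega> (partner C \<omega>)) = palm"
proof (rule measure_eqI)
  note [measurable] = measurable_partner[OF C(1)]
  fix Z assume "Z \<in> sets (distr palm config_space (\<lambda>\<omega>. translate \<omega> (partner C \<omega>)))"
  then have [measurable]: "Z \<in> sets config_space" by simp
  define f :: "'a set \<Rightarrow> 'a \<Rightarrow> ennreal" where
    "f \<omega> x = (if x \<noteq> 0 \<and> partner C \<omega> = x then indicator Z (translate \<omega> x) else 0)" for \<omega> x
  have [measurable]: "case_prod f \<in> borel_measurable (config_space \<Otimes>\<^sub>M borel)"
    unfolding f_def by measurable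
  have point: "(\<integral>\<^sup>+ x. c * indicator {y} x \<partial>count_space \<omega>) = c" if "y \<in> \<omega>" for c :: ennreal and y :: 'a and \<omega>
    using that by (simp add: nn_integral_cmult nn_integral_count_space_indicator_card)
  have "emeasure (distr palm config_space (\<lambda>\<omega>. translate \<omega> (partner C \<omega>))) Z =
      (\<integral>\<^sup>+ \<omega>. indicator Z \<omega> \<partial>distr palm config_space (\<lambda>\<omega>. translate \<omega> (partner C \<omega>)))"
    by simp
  also have "\<dots> = (\<integral>\<^sup>+ \<omega>. indicator Z (translate \<omega> (partner C \<omega>)) \<partial>palm)"
    by (rule nn_integral_distr) measurable
  also have "\<dots> = (\<integral>\<^sup>+ \<omega>. \<integral>\<^sup>+ x. f \<omega> x \<partial>count_space \<omega> \<partial>palm)"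
  proof (rule nn_integral_cong_AE, use AE_palm_zero_mem AE_palm_matched[OF C] in eventually_elim)
    case (elim \<omega>)
    have "(\<integral>\<^sup>+ x. f \<omega> x \<partial>count_space \<omega>) =
        (\<integral>\<^sup>+ x. indicator Z (translate \<omega> (partner C \<omega>)) * indicator {partner C \<omega>} x \<partial>count_space \<omega>)"
      using elim(2) by (intro nn_integral_cong) (auto simp: f_def indicator_def)
    then show ?case using point partner_mem[OF elim(1)] by simp
  qed
  also have "\<dots> = (\<integral>\<^sup>+ \<omega>. \<integral>\<^sup>+ x. f (translate \<omega> x) (- x) \<partial>count_space \<omega> \<partial>palm)"
    by (rule exchange) (measurable, simp add: f_def)
  also have "\<dots> = (\<integral>\<^sup>+ \<omega>. indicator Z \<omega> \<partial>palm)"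
  proof (rule nn_integral_cong_AE, use AE_palm_zero_mem AE_palm_matched[OF C] in eventually_elim)
    case (elim \<omega>)
    have "(\<integral>\<^sup>+ x. f (translate \<omega> x) (- x) \<partial>count_space \<omega>) =
        (\<integral>\<^sup>+ x. indicator Z \<omega> * indicator {partner C \<omega>} x \<partial>count_space \<omega>)"
      using elim(2)
      by (intro nn_integral_cong) (auto simp: f_def indicator_def partner_symmetric)
    then show ?case using point partner_mem[OF elim(1)] by simp
  qed
  also have "\<dots> = emeasure palm Z" by simp
  finally show "emeasure (distr palm config_space (\<lambda>\<omega>. translate \<omega> (partner C \<omega>))) Z = emeasure palm Z" .
qed (simp add: sets_palm)

end


section \<open>From the counting definition of a Poisson process\<close>
lemma nn_integral_poisson:
  fixes N :: "'w \<Rightarrow> nat"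
  assumes "finite_measure M" and [measurable]: "N \<in> measurable M (count_space UNIV)" and a: "a \<ge> 0"
    and N: "\<And>k. measure M {w \<in> space M. N w = k} = a ^ k / fact k * exp (- a)"
  shows "(\<integral>\<^sup>+ w. of_nat (N w) \<partial>M) = ennreal a"
proof -
  interpret finite_measure M by fact
  have "(\<lambda>k. a ^ k /\<^sub>R fact k) sums exp a" by (rule exp_converges)
  then have "(\<lambda>k. (a * exp (- a)) * (a ^ k /\<^sub>R fact k)) sums ((a * exp (- a)) * exp a)"
    by (rule sums_mult)
  also have "(a * exp (- a)) * exp a = a" by (simp add: exp_minus)
  also have "(\<lambda>k. (a * exp (- a)) * (a ^ k /\<^sub>R fact k)) =
      (\<lambda>k. real (Suc k) * (a ^ Suc k / fact (Suc k) * exp (- a)))"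
    by (auto simp: fun_eq_iff fact_Suc field_simps simp del: of_nat_Suc)
  finally have sums: "(\<lambda>k. real k * (a ^ k / fact k * exp (- a))) sums a"
    by (subst (asm) sums_Suc_iff) simp
  have "(\<integral>\<^sup>+ w. of_nat (N w) \<partial>M) =
      (\<integral>\<^sup>+ w. (\<Sum>k. of_nat k * indicator {w \<in> space M. N w = k} w) \<partial>M)"
  proof (rule nn_integral_cong)
    fix w assume "w \<in> space M"
    then have "(\<Sum>k. of_nat k * indicator {w \<in> space M. N w = k} w :: ennreal) =
        (\<Sum>k\<in>{N w}. of_nat k * indicator {w \<in> space M. N w = k} w)"
      by (intro suminf_finite) auto
    then show "of_nat (N w) = (\<Sum>k. of_nat k * indicator {w \<in> space M. N w = k} w :: ennreal)"
      using \<open>w \<in> space M\<close> by simp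
  qed
  also have "\<dots> = (\<Sum>k. of_nat k * emeasure M {w \<in> space M. N w = k})"
    by (subst nn_integral_suminf) (auto simp: nn_integral_cmult_indicator)
  also have "\<dots> = (\<Sum>k. ennreal (real k * (a ^ k / fact k * exp (- a))))"
    by (intro suminf_cong, simp only: emeasure_eq_measure N ennreal_of_nat_eq_real_of_nat)
      (rule ennreal_mult'[symmetric], simp)
  also have "\<dots> = ennreal a"
    using a sums by (intro suminf_ennreal_eq) auto
  finally show ?thesis .
qed

text \<open>The mean on a void event factorizes by the independence of the counts in two disjoint sets. Independence is
stated for families indexed by the sets themselves, so the pair \<open>{A, B}\<close> only has two members if
\<open>A\<close> and \<open>B\<close> are distinct; for disjoint sets this fails only when both are empty.\<close>
lemma poisson_process_law:
  fixes S :: "'w \<Rightarrow> 'a::euclidean_space set"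
  assumes "homogeneous_poisson_process M lam S"
  shows "poisson_law (distr M config_space S) lam"
proof -
  from assms have M: "prob_space M" and lam: "lam > 0" and S [measurable]: "S \<in> measurable M config_space"
    and count: "\<And>A k. A \<in> sets borel \<Longrightarrow> bounded A \<Longrightarrow>
        measure M {w \<in> space M. card (S w \<inter> A) = k} =
          (lam * measure lborel A) ^ k / fact k * exp (- (lam * measure lborel A))"
    and indep: "\<And>\<A>. finite \<A> \<Longrightarrow> disjoint \<A> \<Longrightarrow> (\<And>A. A \<in> \<A> \<Longrightarrow> A \<in> sets borel \<and> bounded A) \<Longrightarrow>
        prob_space.indep_vars M (\<lambda>_. count_space UNIV) (\<lambda>A w. card (S w \<inter> A)) \<A>"
    unfolding homogeneous_poisson_process_def by blast+
  interpret M: prob_space M by (rule M)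
  interpret L: prob_space "distr M config_space S" by (rule M.prob_space_distr) (rule S)
  have fin: "finite (S w \<inter> A)" if "w \<in> space M" "bounded A" for w A
    using measurable_space[OF S that(1)] that(2) by (simp add: finite_config_Int)
  have void_iff: "S w \<in> void_event A \<longleftrightarrow> card (S w \<inter> A) = 0" if "w \<in> space M" "bounded A" for w A
    using measurable_space[OF S that(1)] fin[OF that] by (simp add: void_event_def)
  have card [measurable]: "(\<lambda>w. card (S w \<inter> A)) \<in> measurable M (count_space UNIV)"
    if "A \<in> sets borel" "bounded A" for A
    using measurable_compose[OF S measurable_card_Int[OF that]] by simp
  have void: "emeasure (distr M config_space S) (void_event A) = ennreal (exp (- (lam * measure lborel A)))"
    if A: "A \<in> sets borel" "bounded A" for A
  proof -
    have "emeasure (distr M config_space S) (void_event A) = emeasure M (S -` void_event A \<inter> space M)"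
      using S void_event_in_config[OF A] by (rule emeasure_distr)
    also have "S -` void_event A \<inter> space M = {w \<in> space M. card (S w \<inter> A) = 0}"
      using void_iff A(2) by auto
    finally show ?thesis using count[OF A, of 0] by (simp add: M.emeasure_eq_measure)
  qed
  show ?thesis
  proof (unfold_locales)
    fix A B :: "'a set"
    assume A: "A \<in> sets borel" "bounded A" and B: "B \<in> sets borel" "bounded B" and "A \<inter> B = {}"
    note [measurable] = void_event_in_config[OF A] measurable_card_Int[OF B] card[OF B] card[OF A]
    have mean: "(\<integral>\<^sup>+ w. of_nat (card (S w \<inter> B)) \<partial>M) = ennreal (lam * measure lborel B)"
      using lam by (intro nn_integral_poisson count B) (auto intro: M.finite_measure_axioms)
    have "(\<integral>\<^sup>+ \<omega>. of_nat (card (\<omega> \<inter> B)) * indicator (void_event A) \<omega> \<partial>distr M config_space S) =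
        (\<integral>\<^sup>+ w. of_nat (card (S w \<inter> B)) * indicator (void_event A) (S w) \<partial>M)"
      by (rule nn_integral_distr) measurable
    also have "\<dots> = ennreal (lam * measure lborel B) * emeasure (distr M config_space S) (void_event A)"
    proof (cases "A = {}")
      case True
      then have "(\<integral>\<^sup>+ w. of_nat (card (S w \<inter> B)) * indicator (void_event A) (S w) \<partial>M) =
          (\<integral>\<^sup>+ w. of_nat (card (S w \<inter> B)) \<partial>M)"
        using measurable_space[OF S] by (intro nn_integral_cong) auto
      then show ?thesis using mean void[OF A] True by simp
    next
      case False
      then have "A \<noteq> B" using \<open>A \<inter> B = {}\<close> by auto
      define Y :: "'a set \<Rightarrow> nat \<Rightarrow> ennreal" where
        "Y C = (if C = A then indicator {0} else of_nat)" for C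
      have "M.indep_vars (\<lambda>_. count_space UNIV) (\<lambda>C w. card (S w \<inter> C)) {A, B}"
        using A B \<open>A \<inter> B = {}\<close> by (intro indep) (auto simp: disjoint_def)
      then have "M.indep_vars (\<lambda>_. borel) (\<lambda>C w. Y C (card (S w \<inter> C))) {A, B}"
        by (rule M.indep_vars_compose2) simp
      then have "(\<integral>\<^sup>+ w. (\<Prod>C\<in>{A, B}. Y C (card (S w \<inter> C))) \<partial>M) =
          (\<Prod>C\<in>{A, B}. \<integral>\<^sup>+ w. Y C (card (S w \<inter> C)) \<partial>M)"
        by (intro M.indep_vars_nn_integral) auto
      then have "(\<integral>\<^sup>+ w. indicator {0} (card (S w \<inter> A)) * of_nat (card (S w \<inter> B)) \<partial>M) =
          (\<integral>\<^sup>+ w. indicator {0} (card (S w \<inter> A)) \<partial>M) * ennreal (lam * measure lborel B)"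
        using \<open>A \<noteq> B\<close> mean by (simp add: Y_def)
      moreover have ind: "indicator (void_event A) (S w) = (indicator {0} (card (S w \<inter> A)) :: ennreal)"
        if "w \<in> space M" for w
        using void_iff[OF that A(2)] by (simp only: indicator_def singleton_iff)
      have "(\<integral>\<^sup>+ w. indicator {0} (card (S w \<inter> A)) \<partial>M) = (\<integral>\<^sup>+ w. indicator (void_event A) (S w) \<partial>M)"
        by (intro nn_integral_cong) (simp only: ind)
      also have "\<dots> = (\<integral>\<^sup>+ \<omega>. indicator (void_event A) \<omega> \<partial>distr M config_space S)"
        by (rule nn_integral_distr[symmetric]) measurable
      also have "\<dots> = emeasure (distr M config_space S) (void_event A)" by simp
      moreover have "(\<integral>\<^sup>+ w. of_nat (card (S w \<inter> B)) * indicator (void_event A) (S w) \<partial>M) =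
          (\<integral>\<^sup>+ w. indicator {0} (card (S w \<inter> A)) * of_nat (card (S w \<inter> B)) \<partial>M)"
        by (intro nn_integral_cong) (simp only: ind mult.commute)
      ultimately show ?thesis by (simp add: mult.commute)
    qed
    finally show "(\<integral>\<^sup>+ \<omega>. of_nat (card (\<omega> \<inter> B)) * indicator (void_event A) \<omega> \<partial>distr M config_space S) =
      ennreal (lam * measure lborel B) * emeasure (distr M config_space S) (void_event A)" .
  qed (use lam void in auto)
qed

theorem mainTheorem3:
  fixes M :: "'w measure" and N :: "'v measure"
    and S :: "'w \<Rightarrow> (real ^ 'd) set" and S0 :: "'v \<Rightarrow> (real ^ 'd) set"
    and lam :: real
  assumes "homogeneous_poisson_process M lam S"
    and "palm_version M S N S0"
  shows "\<exists>(\<S> :: (real ^ 'd) set set) (\<pi> :: (real ^ 'd) set \<Rightarrow> real ^ 'd).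
    \<S> \<in> sets config_space \<and>
    (\<forall>\<omega>\<in>\<S>. 0 \<in> \<omega>) \<and>
    measure N {w \<in> space N. S0 w \<in> \<S>} = 1 \<and>
    \<pi> \<in> measurable (restrict_space config_space \<S>) (restrict_space borel (- {0})) \<and>
    (let \<Omega> = {w \<in> space N. S0 w \<in> \<S>}; X = (\<lambda>w. \<pi> (S0 w)) in
      (\<forall>w\<in>\<Omega>. X w \<in> S0 w - {0}) \<and>
      equal_in_distribution
        (restrict_space N \<Omega>) (\<lambda>w. translate (S0 w) (X w))
        N S0 config_space)"
proof -
  interpret L: poisson_law "distr M config_space S" lam
    by (rule poisson_process_law) (rule assms(1))
  have S: "S \<in> measurable M config_space"
    using assms(1) by (simp add: homogeneous_poisson_process_def)
  have N: "prob_space N" and S0 [measurable]: "S0 \<in> measurable N config_space"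
    and "distr N config_space S0 = distr M config_space (\<lambda>w. S w \<union> {0})"
    using assms(2) by (auto simp: palm_version_def equal_in_distribution_def)
  moreover have "distr M config_space (\<lambda>w. S w \<union> {0}) = L.palm"
  proof -
    have "(\<lambda>w. S w \<union> {0}) = insert 0 \<circ> S" by auto
    moreover have "distr (distr M config_space S) config_space (insert 0) =
        distr M config_space (insert 0 \<circ> S)"
      using S by (intro distr_distr) measurable
    ultimately show ?thesis by (simp only: L.palm_def)
  qed
  ultimately have palm: "distr N config_space S0 = L.palm" by simp
  interpret N: prob_space N by (rule N)
  obtain C :: "nat \<Rightarrow> (real ^ 'd) set" where C: "\<And>n. C n \<in> sets borel" "separating C"
    using ex_separating by blast
  note [measurable] = measurable_partner[OF C(1)]
  define \<S> where "\<S> = {\<omega> \<in> space config_space. 0 \<in> \<omega> \<and> partner C \<omega> \<noteq> 0}"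
  define \<Omega> where "\<Omega> = {w \<in> space N. S0 w \<in> \<S>}"
  have \<S> [measurable]: "\<S> \<in> sets config_space" unfolding \<S>_def by measurable
  have \<Omega> [measurable]: "\<Omega> \<in> sets N" unfolding \<Omega>_def by measurable
  have "AE \<omega> in L.palm. \<omega> \<in> \<S>"
    using L.AE_palm_zero_mem L.AE_palm_matched[OF C] AE_space
    by eventually_elim (simp add: \<S>_def sets_eq_imp_space_eq[OF L.sets_palm])
  then have "AE w in N. S0 w \<in> \<S>"
    unfolding palm[symmetric] by (rule AE_distrD[OF S0])
  then have AE_\<Omega>: "AE w in N. w \<in> \<Omega>"
    using AE_space by eventually_elim (simp add: \<Omega>_def)
  have "measure N \<Omega> = 1" using N.prob_eq_1[OF \<Omega>] AE_\<Omega> by simp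
  moreover have "partner C \<in> measurable (restrict_space config_space \<S>) (restrict_space borel (- {0}))"
    by (intro measurable_restrict_space2 measurable_restrict_space1)
      (auto simp: space_restrict_space \<S>_def, measurable)
  moreover have "partner C (S0 w) \<in> S0 w - {0}" if "w \<in> \<Omega>" for w
    using that partner_mem[of "S0 w" C] by (auto simp: \<Omega>_def \<S>_def)
  moreover have "equal_in_distribution (restrict_space N \<Omega>) (\<lambda>w. translate (S0 w) (partner C (S0 w))) N S0 config_space"
    unfolding equal_in_distribution_def
  proof (intro conjI S0)
    have T: "(\<lambda>w. translate (S0 w) (partner C (S0 w))) \<in> measurable N config_space" by measurable
    then show T': "(\<lambda>w. translate (S0 w) (partner C (S0 w))) \<in> measurable (restrict_space N \<Omega>) config_space"
      by (rule measurable_restrict_space1)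
    have "distr (restrict_space N \<Omega>) config_space (\<lambda>w. translate (S0 w) (partner C (S0 w))) =
        distr N config_space (\<lambda>w. translate (S0 w) (partner C (S0 w)))"
    proof (rule measure_eqI)
      fix Z assume "Z \<in> sets (distr (restrict_space N \<Omega>) config_space (\<lambda>w. translate (S0 w) (partner C (S0 w))))"
      then have Z [measurable]: "Z \<in> sets config_space" by simp
      let ?T = "\<lambda>w. translate (S0 w) (partner C (S0 w))"
      have "emeasure (distr (restrict_space N \<Omega>) config_space ?T) Z =
          emeasure (restrict_space N \<Omega>) (?T -` Z \<inter> \<Omega>)"
        using T' Z \<Omega> by (subst emeasure_distr) (auto simp: space_restrict_space2)
      also have "\<dots> = emeasure N (?T -` Z \<inter> \<Omega>)"
        using \<Omega> by (intro emeasure_restrict_space) auto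
      also have "\<dots> = emeasure N (?T -` Z \<inter> space N)"
      proof (rule emeasure_eq_AE)
        show "AE w in N. w \<in> ?T -` Z \<inter> \<Omega> \<longleftrightarrow> w \<in> ?T -` Z \<inter> space N"
          using AE_\<Omega> AE_space by eventually_elim simp
        show N': "?T -` Z \<inter> space N \<in> sets N" using T Z by (rule measurable_sets)
        have "?T -` Z \<inter> \<Omega> = (?T -` Z \<inter> space N) \<inter> \<Omega>" by (auto simp: \<Omega>_def)
        then show "?T -` Z \<inter> \<Omega> \<in> sets N" using N' \<Omega> by simp
      qed
      also have "\<dots> = emeasure (distr N config_space ?T) Z"
        using T Z by (subst emeasure_distr) auto
      finally show "emeasure (distr (restrict_space N \<Omega>) config_space ?T) Z = emeasure (distr N config_space ?T) Z" .
    qed simp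
    also have "\<dots> = distr (distr N config_space S0) config_space (\<lambda>\<omega>. translate \<omega> (partner C \<omega>))"
      by (subst distr_distr) (measurable, simp add: comp_def)
    also have "\<dots> = distr N config_space S0"
      unfolding palm by (rule L.palm_shift_to_partner[OF C])
    finally show "distr (restrict_space N \<Omega>) config_space (\<lambda>w. translate (S0 w) (partner C (S0 w))) =
        distr N config_space S0" .
  qed
  ultimately show ?thesis
    using \<S> unfolding Let_def \<Omega>_def
    by (intro exI[of _ \<S>] exI[of _ "partner C"]) (simp add: \<S>_def)
qed

end
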